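(* Consider the linear IV model, the assumptions and the CLC test described in the context. Suppose we are under weak identification and fixed alternatives, i.e. $\mathcal{C}\to\widetilde{\mathcal{C}}$ for a fixed constant $\widetilde{\mathcal{C}}\in\mathbb{R}$ and $\Delta=\beta-\beta_0$ is fixed, and that Assumptions 1, 2 and 3 hold. Then, for $s\in\{pp,krs\}$, $$\mathcal{A}_s(\widehat D,\widehat\gamma(\beta_0))\rightsquigarrow \mathcal{A}_s(D,\gamma(\beta_0))=\big(a_1(f_s(D,\gamma(\beta_0)),\gamma(\beta_0)),\,a_2(f_s(D,\gamma(\beta_0)),\gamma(\beta_0))\big)$$ and $$\mathbb{E}\,\widehat\phi_{\mathcal{A}_s(\widehat D,\widehat\gamma(\beta_0))}\to \mathbb{E}\,\phi_{a_1(f_s(D,\gamma(\beta_0)),\gamma(\beta_0)),\,a_2(f_s(D,\gamma(\beta_0)),\gamma(\beta_0)),\,\infty}(\Delta,\mu_D,\gamma(\beta_0)),$$ where $D\sim\mathcal{N}(\mu_D,\sigma_D^2)$ is independent of the normal variables $\mathcal{Z}_1(\cdot),\mathcal{Z}_2(\cdot)$ appearing in $\phi_{a_1,a_2,\infty}$. In addition, let $BL_1$ be the class of functions $h:\mathbb{R}\to\mathbb{R}$ that are bounded and Lipschitz with Lipschitz constant $1$. If the null hypothesis holds, so that $\Delta=0$, then for $s\in\{pp,krs\}$, $$\mathbb{E}\big[(\widehat\phi_{\mathcal{A}_s(\widehat D,\widehat\gamma(\beta_0))}-\alpha)\,h(\widehat D)\big]\to 0\qquad\text{for all } h\in BL_1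 .$$
   Context: **Model (drifting sequence in $n$; dependence on $n$ suppressed).** $Y_i=X_i\beta+e_i$, $X_i=\Pi_i+V_i$, $i\in[n]=\{1,\dots,n\}$, all scalar, $\Pi_i=\mathbb{E}X_i$, $\mathbb{E}V_i=\mathbb{E}e_i=0$, $(e_i,V_i)$ possibly heteroskedastic. Instruments $Z_i\in\mathbb{R}^K$ are non-random, $K\to\infty$ with $n$ (possibly at the same order as $n$); $Z$ is the $n\times K$ matrix with rows $Z_i^\top$ and $P=Z(Z^\top Z)^{-1}Z^\top$. $Q_{a,b}=K^{-1/2}\sum_{i\in[n]}\sum_{j\ne i}a_iP_{ij}b_j$; $\mathcal{C}=Q_{\Pi,\Pi}$. $\beta_0$ is the hypothesized value, $\Delta=\beta-\beta_0$, $e_i(\beta_0)=Y_i-X_i\beta_0=e_i+X_i\Delta$. **Assumption 1.** $(Q_{e,e},Q_{X,e},Q_{X,X}-\mathcal{C})^\top\rightsquigarrow\mathcal{N}\left(0,\begin{pmatrix}\Phi_1&\Phi_{12}&\Phi_{13}\\ \Phi_{12}&\Psi&\tau\\ \Phi_{13}&\tau&\Upsilon\end{pmatrix}\right)$ for some $(\Phi_1,\Phi_{12},\Phi_{13},\Psi,\tau,\Upsilon)$. **Variance functions.** $\Phi_1(\beta_0)=\Delta^4\Upsilon+4\Delta^3\tau+\Delta^2(4\Psi+2\Phi_{13})+4\Delta\Phi_{12}+\Phi_1$; $\Phi_{12}(\beta_0)=\Delta^3\Upsilon+3\Delta^2\tau+\Delta(2\Psi+\Phi_{13})+\Phi_{12}$;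 $\Phi_{13}(\beta_0)=\Delta^2\Upsilon+2\Delta\tau+\Phi_{13}$; $\Psi(\beta_0)=\Delta^2\Upsilon+2\Delta\tau+\Psi$; $\tau(\beta_0)=\Delta\Upsilon+\tau$; $\rho(\beta_0)=\Phi_{12}(\beta_0)/\sqrt{\Phi_1(\beta_0)\Psi(\beta_0)}\in(-1,1)$; $\gamma(\beta_0)=(\Phi_1(\beta_0),\Phi_{12}(\beta_0),\Phi_{13}(\beta_0),\Psi(\beta_0),\tau(\beta_0),\Upsilon,\rho(\beta_0))$. **Assumption 2.** $\mathcal{B}\subset\mathbb{R}$ is a compact parameter space, $\inf_{\beta_0\in\mathcal{B}}\Phi_1(\beta_0)>0$, $\inf_{\beta_0\in\mathcal{B}}\Psi(\beta_0)>0$, $\Upsilon>0$, and there is an estimator $\widehat\gamma(\beta_0)=(\widehat\Phi_1(\beta_0),\widehat\Phi_{12}(\beta_0),\widehat\Phi_{13}(\beta_0),\widehat\Psi(\beta_0),\widehat\tau(\beta_0),\widehat\Upsilon,\widehat\rho(\beta_0))$ with $\|\widehat\gamma(\beta_0)-\gamma(\beta_0)\|_2=o_p(1)$ for $\beta_0\in\mathcal{B}$. **Statistics.** $AR(\beta_0)=Q_{e(\beta_0),e(\beta_0)}/\widehat\Phi_1^{1/2}(\beta_0)$, $LM(\beta_0)=Q_{X,e(\beta_0)}/\widehat\Psi^{1/2}(\beta_0)$, $LM^*(\beta_0)=(1-\widehat\rho(\beta_0)^2)^{-1/2}(LM(\beta_0)-\widehat\rho(\beta_0)AR(\beta_0))$,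 $$\widehat D=Q_{X,X}-(Q_{e(\beta_0),e(\beta_0)},Q_{X,e(\beta_0)})\begin{pmatrix}\widehat\Phi_1(\beta_0)&\widehat\Phi_{12}(\beta_0)\\ \widehat\Phi_{12}(\beta_0)&\widehat\Psi(\beta_0)\end{pmatrix}^{-1}\begin{pmatrix}\widehat\Phi_{13}(\beta_0)\\ \widehat\tau(\beta_0)\end{pmatrix}.$$ **Critical values.** $\alpha\in(0,1)$ is the level. $\mathcal{Z}(\mu)$ denotes an $\mathcal{N}(\mu,1)$ variable; $\mathcal{Z}_1(\cdot),\mathcal{Z}_2(\cdot)$ are independent such variables. $\mathbb{C}_\alpha(a_1,a_2;\rho)$ is the $(1-\alpha)$ quantile of $a_1\mathcal{Z}_1^2+a_2(\rho\mathcal{Z}_1+(1-\rho^2)^{1/2}\mathcal{Z}_2)^2+(1-a_1-a_2)\mathcal{Z}_2^2$ with $\mathcal{Z}_1,\mathcal{Z}_2$ independent standard normal. $\mathbb{A}_0=\{(a_1,a_2)\in[0,1]^2:a_1+a_2\le\overline a\}$ for a fixed $\overline a<1$; $\mathbb{C}_{\alpha,\max}(\rho)=\sup_{(a_1,a_2)\in\mathbb{A}_0}\mathbb{C}_\alpha(a_1,a_2;\rho)$. **CLC weights and test.** $\mathcal{D}(\beta_0)=\{\delta:\delta+\beta_0\in\mathcal{B}\}$, $(p_1,p_2)=(0.01,1.1)$. For a vector $r=(\Phi_1,\Phi_{12},\Phi_{13},\Psi,\tau,\Upsilon,\rho)$ in the parameter space $\Gamma$ of $\gamma(\beta_0)$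 put - $G(\delta;r)=1-(\delta^2,\delta)\begin{pmatrix}\Phi_1&\Phi_{12}\\ \Phi_{12}&\Psi\end{pmatrix}^{-1}\begin{pmatrix}\Phi_{13}\\ \tau\end{pmatrix}$, $c_{\mathcal{B}}(r)=\sup_{\delta\in\mathcal{D}(\beta_0)}G(\delta;r)^2$; - $C_1(\delta;r)=\Phi_1^{-1/2}\delta^2/G(\delta;r)$, $C_2(\delta;r)=(1-\rho^2)^{-1/2}(\Psi^{-1/2}\delta-\rho\Phi_1^{-1/2}\delta^2)/G(\delta;r)$; - $\sigma_D(r)=\left(\Upsilon-(\Phi_{13},\tau)\begin{pmatrix}\Phi_1&\Phi_{12}\\ \Phi_{12}&\Psi\end{pmatrix}^{-1}\begin{pmatrix}\Phi_{13}\\ \tau\end{pmatrix}\right)^{1/2}$; - $\Delta_*(r)=\Phi_1^{1/2}\Psi^{-1/2}\rho^{-1}$ (so $1/\Delta_*^4(r)=\Psi^2\rho^4/\Phi_1^2$), $\underline a(\mu,r)=\min\left(p_1,\frac{p_2\,\mathbb{C}_{\alpha,\max}(\rho)\,\Phi_1\,c_{\mathcal{B}}(r)}{\Delta_*^4(r)\mu^2}\right)$ with $C/0=+\infty$ for $C>0$; - $\mathbb{A}(\mu,r)=\{(a_1,a_2)\in\mathbb{A}_0:a_1\ge\underline a(\mu,r)\}$; - $\phi_{a_1,a_2,\infty}(\delta,\mu,r)=1\{a_1\mathcal{Z}_1^2(C_1(\delta;r)\mu)+a_2(\rho\mathcal{Z}_1(C_1(\delta;r)\mu)+(1-\rho^2)^{1/2}\mathcal{Z}_2(C_2(\delta;r)\mu))^2+(1-a_1-a_2)\mathcal{Z}_2^2(C_2(\delta;r)\mu)\ge\mathbb{C}_\alpha(a_1,a_2;\rho)\}$;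 - $(a_1(\mu,r),a_2(\mu,r))$ is a selection from $\arg\min_{(a_1,a_2)\in\mathbb{A}(\mu,r)}\sup_{\delta\in\mathcal{D}(\beta_0)}\big(\sup_{(a_1',a_2')\in\mathbb{A}(\mu,r)}\mathbb{E}\phi_{a_1',a_2',\infty}(\delta,\mu,r)-\mathbb{E}\phi_{a_1,a_2,\infty}(\delta,\mu,r)\big)$; - with $q=d^2/\sigma_D^2(r)$: $f_{pp}(d,r)=\sigma_D(r)\sqrt{\max(q-1,0)}$ and $f_{krs}(d,r)=\sigma_D(r)\sqrt{q-1+e^{-q/2}\big(\sum_{j\ge0}(-q/2)^j\frac{1}{j!(1+2j)}\big)^{-1}}$; - $\mathcal{A}_s(d,r)=(\mathcal{A}_{1,s}(d,r),\mathcal{A}_{2,s}(d,r))=(a_1(f_s(d,r),r),a_2(f_s(d,r),r))$, $s\in\{pp,krs\}$. The feasible jackknife CLC test is, writing $\mathcal{A}_{l,s}=\mathcal{A}_{l,s}(\widehat D,\widehat\gamma(\beta_0))$, $$\widehat\phi_{\mathcal{A}_s(\widehat D,\widehat\gamma(\beta_0))}=1\{\mathcal{A}_{1,s}AR^2(\beta_0)+\mathcal{A}_{2,s}LM^2(\beta_0)+(1-\mathcal{A}_{1,s}-\mathcal{A}_{2,s})LM^{*2}(\beta_0)\ge\mathbb{C}_\alpha(\mathcal{A}_{1,s},\mathcal{A}_{2,s};\widehat\rho(\beta_0))\}.$$ **Limit of $\widehat D$ under weak identification.** $\mu_D=\widetilde{\mathcal{C}}\,G(\Delta;\gamma(\beta_0))$,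 $\sigma_D=\sigma_D(\gamma(\beta_0))$, $D\sim\mathcal{N}(\mu_D,\sigma_D^2)$. Note $C_1(\Delta;\gamma(\beta_0))\mu_D=\Phi_1^{-1/2}(\beta_0)\Delta^2\widetilde{\mathcal{C}}$ and $C_2(\Delta;\gamma(\beta_0))\mu_D=(1-\rho^2(\beta_0))^{-1/2}(\Psi^{-1/2}(\beta_0)\Delta-\rho(\beta_0)\Phi_1^{-1/2}(\beta_0)\Delta^2)\widetilde{\mathcal{C}}$. **Assumption 3.** Let $\mathcal{S}_s$ be the set of discontinuities of $\mathcal{A}_s(\cdot,\gamma(\beta_0)):\mathbb{R}\to[0,1]\times[0,1]$. For $s\in\{pp,krs\}$, $\mathcal{A}_s(d,r)$ is continuous in $r$ for any $d\in\mathbb{R}\setminus\mathcal{S}_s$, and $\mathcal{S}_s$ has Lebesgue measure zero.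
   Formalization: Assumption 3 is taken as continuity of A_s(d,r) jointly in (d,r) at (d,γ(β0)) for d outside S_s, since continuity in r for each fixed d does not suffice: the claimed limit can then fail, e.g. when B={β0}={β} and D-hat is discrete. *)

theory Defs
  imports "HOL-Probability.Probability" "Jordan_Normal_Form.Gauss_Jordan_Elimination"
begin

section \<open>Laws and modes of convergence\<close>

text \<open>\<^term>\<open>v\<close> is the variance, which may be \<open>0\<close>. Only meant for \<open>v \<ge> 0\<close>.\<close>
definition normal_law :: "real \<Rightarrow> real \<Rightarrow> real measure" where
  "normal_law m v =
     (if v = 0 then return borel m else density lborel (\<lambda>x. ennreal (normal_density m (sqrt v) x)))"

text \<open>\<open>\<nu> = N(m, S)\<close>, with \<open>S\<close> possibly singular: the law of \<open>m + L z\<close> for \<open>z\<close> a vector of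
  independent standard normals and \<open>S = L L\<^sup>T\<close>.\<close>
definition multivariate_normal :: "real^'n \<Rightarrow> real^'n^'n \<Rightarrow> (real^'n) measure \<Rightarrow> bool" where
  "multivariate_normal m S \<nu> \<longleftrightarrow>
     (\<exists>L :: real^'n^'n. S = L ** Finite_Cartesian_Product.transpose L \<and>
        \<nu> = distr (PiM UNIV (\<lambda>_. std_normal_distribution)) borel (\<lambda>z. m + L *v (\<chi> i. z i)))"

text \<open>The law of \<open>X n\<close> under \<open>M n\<close> converges weakly to \<open>\<nu>\<close>.\<close>
definition conv_in_law ::
    "(nat \<Rightarrow> 'a measure) \<Rightarrow> (nat \<Rightarrow> 'a \<Rightarrow> 'b :: topological_space) \<Rightarrow> 'b measure \<Rightarrow> bool" where
  "conv_in_law M X \<nu> \<longleftrightarrow>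
     (\<forall>f :: 'b \<Rightarrow> real. continuous_on UNIV f \<and> bounded (range f) \<longrightarrow>
        (\<lambda>n. \<integral>\<omega>. f (X n \<omega>) \<partial>M n) \<longlonglongrightarrow> (\<integral>x. f x \<partial>\<nu>))"

definition conv_in_prob ::
    "(nat \<Rightarrow> 'a measure) \<Rightarrow> (nat \<Rightarrow> 'a \<Rightarrow> 'b :: real_normed_vector) \<Rightarrow> 'b \<Rightarrow> bool" where
  "conv_in_prob M X c \<longleftrightarrow>
     (\<forall>\<epsilon>>0. (\<lambda>n. measure (M n) {\<omega> \<in> space (M n). \<epsilon> \<le> norm (X n \<omega> - c)}) \<longlonglongrightarrow> 0)"

definition quantile :: "real measure \<Rightarrow> real \<Rightarrow> real" where
  "quantile \<nu> p = Inf {x. p \<le> cdf \<nu> x}"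


section \<open>The many-instrument model\<close>

definition proj_mat :: "real mat \<Rightarrow> real mat" where
  "proj_mat Z = Z * the (mat_inverse (transpose_mat Z * Z)) * transpose_mat Z"

text \<open>Observations are indexed by \<open>i < n\<close>; \<open>mX n i\<close> is the mean of \<open>X n i\<close>.\<close>
definition iv_model ::
    "(nat \<Rightarrow> 'a measure) \<Rightarrow> (nat \<Rightarrow> nat) \<Rightarrow> (nat \<Rightarrow> real mat) \<Rightarrow> real \<Rightarrow> (nat \<Rightarrow> nat \<Rightarrow> real) \<Rightarrow>
     (nat \<Rightarrow> nat \<Rightarrow> 'a \<Rightarrow> real) \<Rightarrow> (nat \<Rightarrow> nat \<Rightarrow> 'a \<Rightarrow> real) \<Rightarrow>
     (nat \<Rightarrow> nat \<Rightarrow> 'a \<Rightarrow> real) \<Rightarrow> (nat \<Rightarrow> nat \<Rightarrow> 'a \<Rightarrow> real) \<Rightarrow> bool" where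
  "iv_model M K Z \<beta> mX V e X Y \<longleftrightarrow>
     (\<forall>n. prob_space (M n)) \<and>
     filterlim K at_top sequentially \<and>
     (\<forall>n\<ge>1. Z n \<in> carrier_mat n (K n) \<and> invertible_mat (transpose_mat (Z n) * Z n)) \<and>
     (\<forall>n. \<forall>i<n.
        integrable (M n) (V n i) \<and> (\<integral>\<omega>. V n i \<omega> \<partial>M n) = 0 \<and>
        integrable (M n) (e n i) \<and> (\<integral>\<omega>. e n i \<omega> \<partial>M n) = 0 \<and>
        mX n i = (\<integral>\<omega>. X n i \<omega> \<partial>M n) \<and>
        (\<forall>\<omega>\<in>space (M n). X n i \<omega> = mX n i + V n i \<omega> \<and> Y n i \<omega> = X n i \<omega> * \<beta> + e n i \<omega>))"

definition Qform :: "nat \<Rightarrow> nat \<Rightarrow> real mat \<Rightarrow> (nat \<Rightarrow> real) \<Rightarrow> (nat \<Rightarrow> real) \<Rightarrow> real" where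
  "Qform n K Z a b =
     (\<Sum>i<n. \<Sum>j\<in>{..<n} - {i}. a i * proj_mat Z $$ (i, j) * b j) / sqrt (real K)"

definition resid :: "(nat \<Rightarrow> nat \<Rightarrow> 'a \<Rightarrow> real) \<Rightarrow> (nat \<Rightarrow> nat \<Rightarrow> 'a \<Rightarrow> real) \<Rightarrow> real \<Rightarrow>
    nat \<Rightarrow> nat \<Rightarrow> 'a \<Rightarrow> real" where
  "resid X Y b n i \<omega> = Y n i \<omega> - X n i \<omega> * b"


section \<open>Variance parameters\<close>

text \<open>\<open>(\<Phi>\<^sub>1, \<Phi>\<^sub>1\<^sub>2, \<Phi>\<^sub>1\<^sub>3, \<Psi>, \<tau>, \<Upsilon>)\<close>, the entries of the limiting covariance matrix.\<close>
type_synonym cov_param = "real \<times> real \<times> real \<times> real \<times> real \<times> real"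

text \<open>\<open>(\<Phi>\<^sub>1, \<Phi>\<^sub>1\<^sub>2, \<Phi>\<^sub>1\<^sub>3, \<Psi>, \<tau>, \<Upsilon>, \<rho>)\<close>. The norm of this product type is the Euclidean one.\<close>
type_synonym gam = "real \<times> real \<times> real \<times> real \<times> real \<times> real \<times> real"

fun cov_matrix :: "cov_param \<Rightarrow> real^3^3" where
  "cov_matrix (\<Phi>1, \<Phi>12, \<Phi>13, \<Psi>, \<tau>, \<Upsilon>) =
     vector [vector [\<Phi>1, \<Phi>12, \<Phi>13], vector [\<Phi>12, \<Psi>, \<tau>], vector [\<Phi>13, \<tau>, \<Upsilon>]]"

text \<open>The variance functions at a hypothesized value \<open>b\<close>, with \<open>\<Delta> = \<beta> - b\<close>.\<close>

fun Phi1_at :: "cov_param \<Rightarrow> real \<Rightarrow> real" where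
  "Phi1_at (\<Phi>1, \<Phi>12, \<Phi>13, \<Psi>, \<tau>, \<Upsilon>) \<Delta> =
     \<Delta>^4 * \<Upsilon> + 4 * \<Delta>^3 * \<tau> + \<Delta>^2 * (4 * \<Psi> + 2 * \<Phi>13) + 4 * \<Delta> * \<Phi>12 + \<Phi>1"

fun Phi12_at :: "cov_param \<Rightarrow> real \<Rightarrow> real" where
  "Phi12_at (\<Phi>1, \<Phi>12, \<Phi>13, \<Psi>, \<tau>, \<Upsilon>) \<Delta> =
     \<Delta>^3 * \<Upsilon> + 3 * \<Delta>^2 * \<tau> + \<Delta> * (2 * \<Psi> + \<Phi>13) + \<Phi>12"

fun Phi13_at :: "cov_param \<Rightarrow> real \<Rightarrow> real" where
  "Phi13_at (\<Phi>1, \<Phi>12, \<Phi>13, \<Psi>, \<tau>, \<Upsilon>) \<Delta> = \<Delta>^2 * \<Upsilon> + 2 * \<Delta> * \<tau> + \<Phi>13"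

fun Psi_at :: "cov_param \<Rightarrow> real \<Rightarrow> real" where
  "Psi_at (\<Phi>1, \<Phi>12, \<Phi>13, \<Psi>, \<tau>, \<Upsilon>) \<Delta> = \<Delta>^2 * \<Upsilon> + 2 * \<Delta> * \<tau> + \<Psi>"

fun tau_at :: "cov_param \<Rightarrow> real \<Rightarrow> real" where
  "tau_at (\<Phi>1, \<Phi>12, \<Phi>13, \<Psi>, \<tau>, \<Upsilon>) \<Delta> = \<Delta> * \<Upsilon> + \<tau>"

fun Upsilon_of :: "cov_param \<Rightarrow> real" where
  "Upsilon_of (\<Phi>1, \<Phi>12, \<Phi>13, \<Psi>, \<tau>, \<Upsilon>) = \<Upsilon>"

definition rho_at :: "cov_param \<Rightarrow> real \<Rightarrow> real" where
  "rho_at \<theta> \<Delta> = Phi12_at \<theta> \<Delta> / sqrt (Phi1_at \<theta> \<Delta> * Psi_at \<theta> \<Delta>)"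

definition gamma_at :: "cov_param \<Rightarrow> real \<Rightarrow> gam" where
  "gamma_at \<theta> \<Delta> = (Phi1_at \<theta> \<Delta>, Phi12_at \<theta> \<Delta>, Phi13_at \<theta> \<Delta>, Psi_at \<theta> \<Delta>, tau_at \<theta> \<Delta>,
     Upsilon_of \<theta>, rho_at \<theta> \<Delta>)"

fun rho_of :: "gam \<Rightarrow> real" where
  "rho_of (\<Phi>1, \<Phi>12, \<Phi>13, \<Psi>, \<tau>, \<Upsilon>, \<rho>) = \<rho>"

text \<open>The \<open>2 \<times> 2\<close> inverse applied to \<open>(\<Phi>\<^sub>1\<^sub>3, \<tau>)\<^sup>T\<close> that enters \<open>G\<close>, \<open>\<sigma>\<^sub>D\<close> and the statistic \<open>D\<close>.\<close>
fun proj_coef :: "gam \<Rightarrow> real^2" where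
  "proj_coef (\<Phi>1, \<Phi>12, \<Phi>13, \<Psi>, \<tau>, \<Upsilon>, \<rho>) =
     matrix_inv (vector [vector [\<Phi>1, \<Phi>12], vector [\<Phi>12, \<Psi>]] :: real^2^2) *v vector [\<Phi>13, \<tau>]"

definition G_fun :: "real \<Rightarrow> gam \<Rightarrow> real" where
  "G_fun \<delta> r = 1 - inner (vector [\<delta>^2, \<delta>]) (proj_coef r)"

fun sigma_D :: "gam \<Rightarrow> real" where
  "sigma_D (\<Phi>1, \<Phi>12, \<Phi>13, \<Psi>, \<tau>, \<Upsilon>, \<rho>) =
     sqrt (\<Upsilon> - inner (vector [\<Phi>13, \<tau>]) (proj_coef (\<Phi>1, \<Phi>12, \<Phi>13, \<Psi>, \<tau>, \<Upsilon>, \<rho>)))"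

text \<open>The numerators of \<open>C\<^sub>1\<close> and \<open>C\<^sub>2\<close>. With \<open>\<mu>\<^sub>D = Ct * G\<close> one has \<open>C\<^sub>l * \<mu>\<^sub>D = C\<^sub>l_num * Ct\<close>, and the
  right-hand side also makes sense where \<open>G\<close> vanishes.\<close>

fun C1_num :: "real \<Rightarrow> gam \<Rightarrow> real" where
  "C1_num \<delta> (\<Phi>1, \<Phi>12, \<Phi>13, \<Psi>, \<tau>, \<Upsilon>, \<rho>) = \<delta>^2 / sqrt \<Phi>1"

fun C2_num :: "real \<Rightarrow> gam \<Rightarrow> real" where
  "C2_num \<delta> (\<Phi>1, \<Phi>12, \<Phi>13, \<Psi>, \<tau>, \<Upsilon>, \<rho>) =
     (\<delta> / sqrt \<Psi> - \<rho> * \<delta>^2 / sqrt \<Phi>1) / sqrt (1 - \<rho>^2)"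

text \<open>Where \<open>G\<close> vanishes the quotients \<open>C\<^sub>1\<close>, \<open>C\<^sub>2\<close> are undefined; here they are \<open>0\<close>. Such a \<open>\<delta>\<close> then
  contributes a zero term to the supremum in \<open>max_regret\<close> below, whose terms are nonnegative for
  admissible weights, so that it does not influence the minimization.\<close>

definition C1 :: "real \<Rightarrow> gam \<Rightarrow> real" where
  "C1 \<delta> r = C1_num \<delta> r / G_fun \<delta> r"

definition C2 :: "real \<Rightarrow> gam \<Rightarrow> real" where
  "C2 \<delta> r = C2_num \<delta> r / G_fun \<delta> r"


section \<open>Critical values and weights\<close>

definition clc_stat :: "real \<times> real \<Rightarrow> real \<Rightarrow> real \<times> real \<Rightarrow> real" where
  "clc_stat a \<rho> z =
     fst a * (fst z)^2 + snd a * (\<rho> * fst z + sqrt (1 - \<rho>^2) * snd z)^2 +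
     (1 - fst a - snd a) * (snd z)^2"

definition crit :: "real \<Rightarrow> real \<times> real \<Rightarrow> real \<Rightarrow> real" where
  "crit \<alpha> a \<rho> =
     quantile (distr (std_normal_distribution \<Otimes>\<^sub>M std_normal_distribution) borel (clc_stat a \<rho>)) (1 - \<alpha>)"

definition A0 :: "real \<Rightarrow> (real \<times> real) set" where
  "A0 abar = {(a1, a2). a1 \<in> {0..1} \<and> a2 \<in> {0..1} \<and> a1 + a2 \<le> abar}"

definition crit_max :: "real \<Rightarrow> real \<Rightarrow> real \<Rightarrow> real" where
  "crit_max \<alpha> abar \<rho> = (SUP a\<in>A0 abar. crit \<alpha> a \<rho>)"

definition Dset :: "real set \<Rightarrow> real \<Rightarrow> real set" where
  "Dset B \<beta>0 = {\<delta>. \<delta> + \<beta>0 \<in> B}"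

definition c_B :: "real set \<Rightarrow> real \<Rightarrow> gam \<Rightarrow> real" where
  "c_B B \<beta>0 r = (SUP \<delta>\<in>Dset B \<beta>0. (G_fun \<delta> r)^2)"

text \<open>\<open>1 / \<Delta>\<^sub>*\<^sup>4\<close>\<close>
fun inv_Delta_star4 :: "gam \<Rightarrow> real" where
  "inv_Delta_star4 (\<Phi>1, \<Phi>12, \<Phi>13, \<Psi>, \<tau>, \<Upsilon>, \<rho>) = \<Psi>^2 * \<rho>^4 / \<Phi>1^2"

fun Phi1_of :: "gam \<Rightarrow> real" where
  "Phi1_of (\<Phi>1, \<Phi>12, \<Phi>13, \<Psi>, \<tau>, \<Upsilon>, \<rho>) = \<Phi>1"

text \<open>With \<open>(p\<^sub>1, p\<^sub>2) = (0.01, 1.1)\<close>. Division is that of \<^typ>\<open>ereal\<close>, so \<open>C / 0 = \<infinity>\<close> for \<open>C > 0\<close>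
  (and \<open>0 / 0 = 0\<close>, which arises only for \<open>\<mu> = \<rho> = 0\<close>).\<close>
definition a_low :: "real \<Rightarrow> real \<Rightarrow> real set \<Rightarrow> real \<Rightarrow> real \<Rightarrow> gam \<Rightarrow> real" where
  "a_low \<alpha> abar B \<beta>0 \<mu> r = real_of_ereal (min (ereal (1/100))
     (ereal (11/10 * crit_max \<alpha> abar (rho_of r) * Phi1_of r * c_B B \<beta>0 r * inv_Delta_star4 r)
        / ereal (\<mu>^2)))"

definition Aset :: "real \<Rightarrow> real \<Rightarrow> real set \<Rightarrow> real \<Rightarrow> real \<Rightarrow> gam \<Rightarrow> (real \<times> real) set" where
  "Aset \<alpha> abar B \<beta>0 \<mu> r = {a \<in> A0 abar. a_low \<alpha> abar B \<beta>0 \<mu> r \<le> fst a}"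

text \<open>The limit test \<open>\<phi>\<^sub>a\<^sub>,\<^sub>\<infinity>\<close> at the realisations \<open>z = (z\<^sub>1, z\<^sub>2)\<close> of the two normal variables, whose
  law for given \<open>\<delta>\<close>, \<open>\<mu>\<close>, \<open>r\<close> is \<open>noise \<delta> \<mu> r\<close>.\<close>

definition phi_inf :: "real \<Rightarrow> real \<times> real \<Rightarrow> real \<Rightarrow> real \<times> real \<Rightarrow> real" where
  "phi_inf \<alpha> a \<rho> z = (if crit \<alpha> a \<rho> \<le> clc_stat a \<rho> z then 1 else 0)"

definition normal_pair :: "real \<Rightarrow> real \<Rightarrow> (real \<times> real) measure" where
  "normal_pair m1 m2 = normal_law m1 1 \<Otimes>\<^sub>M normal_law m2 1"

definition noise :: "real \<Rightarrow> real \<Rightarrow> gam \<Rightarrow> (real \<times> real) measure" where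
  "noise \<delta> \<mu> r = normal_pair (C1 \<delta> r * \<mu>) (C2 \<delta> r * \<mu>)"

definition E_phi :: "real \<Rightarrow> real \<times> real \<Rightarrow> real \<Rightarrow> real \<Rightarrow> gam \<Rightarrow> real" where
  "E_phi \<alpha> a \<delta> \<mu> r = (\<integral>z. phi_inf \<alpha> a (rho_of r) z \<partial>noise \<delta> \<mu> r)"

definition max_regret ::
    "real \<Rightarrow> real \<Rightarrow> real set \<Rightarrow> real \<Rightarrow> real \<Rightarrow> gam \<Rightarrow> real \<times> real \<Rightarrow> real" where
  "max_regret \<alpha> abar B \<beta>0 \<mu> r a =
     (SUP \<delta>\<in>Dset B \<beta>0. (SUP a'\<in>Aset \<alpha> abar B \<beta>0 \<mu> r. E_phi \<alpha> a' \<delta> \<mu> r) - E_phi \<alpha> a \<delta> \<mu> r)"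

definition weight_selection ::
    "real \<Rightarrow> real \<Rightarrow> real set \<Rightarrow> real \<Rightarrow> gam set \<Rightarrow> (real \<Rightarrow> gam \<Rightarrow> real \<times> real) \<Rightarrow> bool" where
  "weight_selection \<alpha> abar B \<beta>0 \<Gamma> a \<longleftrightarrow>
     (\<forall>\<mu>. \<forall>r\<in>\<Gamma>. is_arg_min (max_regret \<alpha> abar B \<beta>0 \<mu> r) (\<lambda>a'. a' \<in> Aset \<alpha> abar B \<beta>0 \<mu> r) (a \<mu> r))"

datatype rule = PP | KRS

fun f_rule :: "rule \<Rightarrow> real \<Rightarrow> gam \<Rightarrow> real" where
  "f_rule PP d r = sigma_D r * sqrt (max (d^2 / (sigma_D r)^2 - 1) 0)"
| "f_rule KRS d r =
     (let q = d^2 / (sigma_D r)^2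
      in sigma_D r * sqrt (q - 1 +
           exp (- q / 2) * inverse (\<Sum>j. (- q / 2)^j * (1 / (fact j * (1 + 2 * real j))))))"

definition weights :: "(real \<Rightarrow> gam \<Rightarrow> real \<times> real) \<Rightarrow> rule \<Rightarrow> real \<Rightarrow> gam \<Rightarrow> real \<times> real" where
  "weights a s d r = a (f_rule s d r) r"


section \<open>The feasible test\<close>

text \<open>As functions of the estimate \<open>g\<close> of \<open>\<gamma>(\<beta>\<^sub>0)\<close> and of \<open>qee\<close>, \<open>qXe\<close>, \<open>qXX\<close>, which stand for
  \<open>Q\<^bsub>e(\<beta>\<^sub>0),e(\<beta>\<^sub>0)\<^esub>\<close>, \<open>Q\<^bsub>X,e(\<beta>\<^sub>0)\<^esub>\<close>, \<open>Q\<^bsub>X,X\<^esub>\<close>.\<close>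

fun AR_stat :: "gam \<Rightarrow> real \<Rightarrow> real" where
  "AR_stat (\<Phi>1, \<Phi>12, \<Phi>13, \<Psi>, \<tau>, \<Upsilon>, \<rho>) qee = qee / sqrt \<Phi>1"

fun LM_stat :: "gam \<Rightarrow> real \<Rightarrow> real" where
  "LM_stat (\<Phi>1, \<Phi>12, \<Phi>13, \<Psi>, \<tau>, \<Upsilon>, \<rho>) qXe = qXe / sqrt \<Psi>"

definition LMstar_stat :: "gam \<Rightarrow> real \<Rightarrow> real \<Rightarrow> real" where
  "LMstar_stat g qee qXe = (LM_stat g qXe - rho_of g * AR_stat g qee) / sqrt (1 - (rho_of g)^2)"

definition D_stat :: "gam \<Rightarrow> real \<Rightarrow> real \<Rightarrow> real \<Rightarrow> real" where
  "D_stat g qee qXe qXX = qXX - inner (vector [qee, qXe]) (proj_coef g)"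

definition clc_test :: "real \<Rightarrow> real \<times> real \<Rightarrow> gam \<Rightarrow> real \<Rightarrow> real \<Rightarrow> real" where
  "clc_test \<alpha> A g qee qXe =
     (if crit \<alpha> A (rho_of g) \<le>
           fst A * (AR_stat g qee)^2 + snd A * (LM_stat g qXe)^2
           + (1 - fst A - snd A) * (LMstar_stat g qee qXe)^2
      then 1 else 0)"

definition Q_ee0 where
  "Q_ee0 K Z X Y \<beta>0 n \<omega> =
     Qform n (K n) (Z n) (\<lambda>i. resid X Y \<beta>0 n i \<omega>) (\<lambda>i. resid X Y \<beta>0 n i \<omega>)"

definition Q_Xe0 where
  "Q_Xe0 K Z X Y \<beta>0 n \<omega> =
     Qform n (K n) (Z n) (\<lambda>i. X n i \<omega>) (\<lambda>i. resid X Y \<beta>0 n i \<omega>)"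

definition Q_XX where
  "Q_XX K Z X n \<omega> = Qform n (K n) (Z n) (\<lambda>i. X n i \<omega>) (\<lambda>i. X n i \<omega>)"

definition conc :: "(nat \<Rightarrow> nat) \<Rightarrow> (nat \<Rightarrow> real mat) \<Rightarrow> (nat \<Rightarrow> nat \<Rightarrow> real) \<Rightarrow> nat \<Rightarrow> real" where
  "conc K Z mX n = Qform n (K n) (Z n) (mX n) (mX n)"

text \<open>\<open>gh n b \<omega>\<close> is the estimator of \<open>\<gamma>(b)\<close>.\<close>

definition D_hat where
  "D_hat K Z X Y \<beta>0 gh n \<omega> =
     D_stat (gh n \<beta>0 \<omega>) (Q_ee0 K Z X Y \<beta>0 n \<omega>) (Q_Xe0 K Z X Y \<beta>0 n \<omega>) (Q_XX K Z X n \<omega>)"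

definition A_hat where
  "A_hat K Z X Y \<beta>0 gh a s n \<omega> = weights a s (D_hat K Z X Y \<beta>0 gh n \<omega>) (gh n \<beta>0 \<omega>)"

definition phi_hat where
  "phi_hat \<alpha> K Z X Y \<beta>0 gh a s n \<omega> =
     clc_test \<alpha> (A_hat K Z X Y \<beta>0 gh a s n \<omega>) (gh n \<beta>0 \<omega>)
       (Q_ee0 K Z X Y \<beta>0 n \<omega>) (Q_Xe0 K Z X Y \<beta>0 n \<omega>)"


section \<open>Assumptions\<close>

definition assumption1 where
  "assumption1 M K Z mX e X \<theta> \<longleftrightarrow>
     (\<exists>\<nu>. multivariate_normal 0 (cov_matrix \<theta>) \<nu> \<and>
        conv_in_law M
          (\<lambda>n \<omega>. vector
             [Qform n (K n) (Z n) (\<lambda>i. e n i \<omega>) (\<lambda>i. e n i \<omega>),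
              Qform n (K n) (Z n) (\<lambda>i. X n i \<omega>) (\<lambda>i. e n i \<omega>),
              Q_XX K Z X n \<omega> - conc K Z mX n] :: real^3) \<nu>)"

definition assumption2 ::
    "(nat \<Rightarrow> 'a measure) \<Rightarrow> real set \<Rightarrow> real \<Rightarrow> cov_param \<Rightarrow> (nat \<Rightarrow> real \<Rightarrow> 'a \<Rightarrow> gam) \<Rightarrow> bool" where
  "assumption2 M B \<beta> \<theta> gh \<longleftrightarrow>
     compact B \<and>
     0 < (INF b\<in>B. Phi1_at \<theta> (\<beta> - b)) \<and>
     0 < (INF b\<in>B. Psi_at \<theta> (\<beta> - b)) \<and>
     0 < Upsilon_of \<theta> \<and>
     (\<forall>b\<in>B. (\<forall>n. gh n b \<in> borel_measurable (M n)) \<and>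
        conv_in_prob M (\<lambda>n. gh n b) (gamma_at \<theta> (\<beta> - b)))"

definition discont :: "(real \<Rightarrow> gam \<Rightarrow> real \<times> real) \<Rightarrow> rule \<Rightarrow> gam \<Rightarrow> real set" where
  "discont a s \<gamma>0 = {d. \<not> isCont (\<lambda>d'. weights a s d' \<gamma>0) d}"

text \<open>Off the discontinuity set the weights are continuous in \<open>(d, r)\<close> at \<open>(d, \<gamma>(\<beta>\<^sub>0))\<close>, which is
  what the continuous mapping theorem requires; continuity in \<open>r\<close> separately for each \<open>d\<close> would
  not suffice.\<close>
definition assumption3 :: "(real \<Rightarrow> gam \<Rightarrow> real \<times> real) \<Rightarrow> gam set \<Rightarrow> gam \<Rightarrow> bool" where
  "assumption3 a \<Gamma> \<gamma>0 \<longleftrightarrow>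
     (\<forall>s. discont a s \<gamma>0 \<in> null_sets lebesgue \<and>
        (\<forall>d. d \<notin> discont a s \<gamma>0 \<longrightarrow>
           continuous (at (d, \<gamma>0) within UNIV \<times> \<Gamma>) (\<lambda>(d', r). weights a s d' r)))"

end

theory Submission
  imports Defs
begin

text \<open>By symmetry of the projection matrix, the three quadratic forms entering the test are a fixed
  affine image of the vector in Assumption 1, up to the deterministic shift \<open>conc\<close>. Hence \<open>AR\<close>, \<open>LM\<^sup>*\<close>
  and \<open>D\<close> converge jointly to three independent normal variables: the Gram matrix of the limiting
  linear functionals is \<open>diag(1, 1, \<sigma>\<^sub>D\<^sup>2)\<close>, so after an orthogonal change of coordinates, which
  preserves the standard normal law, the limit has independent coordinates. A continuous mapping
  theorem for a weakly convergent and a consistent component carries this over to the test. Its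
  hypothesis, almost sure continuity at the limit, holds because \<open>crit \<alpha> a \<rho> \<le> x\<close> is equivalent to
  \<open>1 - \<alpha> \<le> F(a, \<rho>, x)\<close> with \<open>F\<close> the distribution function of the weighted statistic, which is
  jointly continuous and almost surely different from \<open>1 - \<alpha>\<close>.\<close>

section \<open>A continuous mapping theorem\<close>

text \<open>The obstacle is that the weights, and with them the critical value, are random and may
  jump: they are known to be continuous only relative to \<open>UNIV \<times> \<Gamma>\<close>, and
  only off a null set of values of \<open>D\<close>. The mapping theorem is therefore phrased with
  continuity within \<open>UNIV \<times> S\<close>, the estimator being confined to
  \<open>S\<close>. The distribution function that replaces the critical value is taken at mean
  zero, whereas under an alternative the limiting noise has shifted means. This is harmless because
  all unit-variance normal pairs have the same null sets. Absence of atoms comes from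
  \<open>abar < 1\<close>: the last weight is at least \<open>1 - abar\<close>, so given the first
  normal the statistic is a genuine quadratic in the second. Independence of \<open>D\<close> from
  the noise is used twice. Given \<open>D = d\<close> the weights are constants, so statements for
  fixed weights can be integrated over \<open>d\<close>. Under the null the noise is centred as
  well, so the test has size exactly \<alpha> for every \<open>d\<close>, which annihilates the
  limit for any factor \<open>h d\<close>.\<close>

text \<open>Upper bounds for \<open>F\<close> come from its Lipschitz envelopes \<open>H k\<close>, which are continuous in \<open>w\<close> and
  decrease to \<open>F (w, c)\<close> at continuity points.\<close>
lemma conv_in_law_prob_upper:
  fixes F :: "'b::metric_space \<times> 'c::euclidean_space \<Rightarrow> real"
  assumes M: "\<And>n. prob_space (M n)" and nu: "prob_space \<nu>" "sets \<nu> = sets borel"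
    and W: "\<And>n. W n \<in> borel_measurable (M n)" "conv_in_law M W \<nu>"
    and G: "\<And>n. G n \<in> borel_measurable (M n)" "conv_in_prob M G c"
    and S: "c \<in> S" "\<And>n \<omega>. \<omega> \<in> space (M n) \<Longrightarrow> G n \<omega> \<in> S"
    and C: "\<And>p. \<bar>F p\<bar> \<le> C"
    and FM: "\<And>n. (\<lambda>\<omega>. F (W n \<omega>, G n \<omega>)) \<in> borel_measurable (M n)"
    and Fnu: "(\<lambda>w. F (w, c)) \<in> borel_measurable \<nu>"
    and cont: "AE w in \<nu>. continuous (at (w, c) within UNIV \<times> S) F"
    and eps: "0 < \<epsilon>"
  shows "\<forall>\<^sub>F n in sequentially. (\<integral>\<omega>. F (W n \<omega>, G n \<omega>) \<partial>M n) < (\<integral>w. F (w, c) \<partial>\<nu>) + \<epsilon>"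
proof -
  interpret nu: prob_space \<nu> by fact
  \<comment> \<open>The penalty also charges the distance from \<open>c\<close> to the second
    argument. This gives \<open>F (w, g) \<le> H k w + k * dist c g\<close>, so the consistent
    component is absorbed without a joint weak limit.\<close>
  define H where "H k w = (SUP p\<in>UNIV \<times> S. F p - real k * (dist w (fst p) + dist c (snd p)))" for k w
  have ub: "F p - real k * (dist w (fst p) + dist c (snd p)) \<le> C" for p k w
  proof -
    have "0 \<le> real k * (dist w (fst p) + dist c (snd p))" by simp
    then show ?thesis using C[of p] by linarith
  qed
  have bdd: "bdd_above ((\<lambda>p. F p - real k * (dist w (fst p) + dist c (snd p))) ` (UNIV \<times> S))" for k w
    using ub by (intro bdd_aboveI) blast
  have H_ge: "F (w', g) - real k * (dist w w' + dist c g) \<le> H k w" if "g \<in> S" for w w' g k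
    unfolding H_def using cSUP_upper[OF _ bdd, of "(w', g)"] that by auto
  have H_le: "H k w \<le> b" if "\<And>w' g. g \<in> S \<Longrightarrow> F (w', g) - real k * (dist w w' + dist c g) \<le> b" for k w b
    unfolding H_def using S(1) that by (intro cSUP_least) auto
  have H_lower: "F (w, c) \<le> H k w" for k w
    using H_ge[OF S(1), of w k w] by simp
  have H_bd: "\<bar>H k w\<bar> \<le> C" for k w
  proof -
    have "H k w \<le> C" using ub[of "(_, _)"] by (intro H_le) auto
    moreover have "- C \<le> H k w" using H_lower[of w k] C[of "(w,c)"] by linarith
    ultimately show ?thesis by linarith
  qed
  have lip: "H k w \<le> H k w' + real k * dist w w'" for k w w'
  proof (rule H_le)
    fix v g assume "g \<in> S"
    from H_ge[OF this, of v k w'] have "F (v, g) - real k * (dist w' v + dist c g) \<le> H k w'" .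
    moreover have "real k * dist w' v \<le> real k * (dist w w' + dist w v)"
      by (intro mult_left_mono) (metis dist_commute dist_triangle, simp)
    ultimately show "F (v, g) - real k * (dist w v + dist c g) \<le> H k w' + real k * dist w w'"
      by (simp add: algebra_simps)
  qed
  have Hlip: "(real k)-lipschitz_on UNIV (H k)" for k
  proof (rule lipschitz_onI)
    show "dist (H k x) (H k y) \<le> real k * dist x y" for x y
      using lip[of k x y] lip[of k y x] by (simp add: dist_real_def dist_commute abs_le_iff)
  qed simp
  have Hcont: "continuous_on UNIV (H k)" for k
    using lipschitz_on_continuous_on[OF Hlip] .
  have Hmeas: "H k \<in> borel_measurable borel" for k
    using borel_measurable_continuous_onI[OF Hcont] .
  have Hmeas_nu: "H k \<in> borel_measurable \<nu>" for k
    using Hmeas nu(2) by (simp cong: measurable_cong_sets)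
  have Hlim: "(\<lambda>k. H k w) \<longlonglongrightarrow> F (w, c)" if co: "continuous (at (w, c) within UNIV \<times> S) F" for w
  proof (rule LIMSEQ_I)
    fix r :: real assume r: "0 < r"
    have "\<exists>d>0. \<forall>x\<in>UNIV \<times> S. dist x (w, c) < d \<longrightarrow> dist (F x) (F (w, c)) < r / 2"
      using co half_gt_zero[OF r] unfolding continuous_within_eps_delta by blast
    then obtain d where d: "d > 0"
      "\<And>v g. g \<in> S \<Longrightarrow> dist (v, g) (w, c) < d \<Longrightarrow> \<bar>F (v, g) - F (w, c)\<bar> < r / 2"
      by (auto simp: dist_real_def)
    \<comment> \<open>From \<open>k \<ge> N\<close> on, a point at distance at least
      \<open>d\<close> pays a penalty of at least \<open>2 * C\<close>, the largest possible
      oscillation of \<open>F\<close>, so only nearby points can exceed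
      \<open>F (w, c)\<close>.\<close>
    obtain N :: nat where N: "2 * C / d < real N" using reals_Archimedean2 by blast
    have "norm (H k w - F (w, c)) < r" if k: "N \<le> k" for k
    proof -
      have "H k w \<le> F (w, c) + r / 2"
      proof (rule H_le)
        fix v g assume g: "g \<in> S"
        let ?D = "dist w v + dist c g"
        show "F (v, g) - real k * ?D \<le> F (w, c) + r / 2"
        proof (cases "?D < d")
          case True
          have "dist (v, g) (w, c) \<le> ?D"
            unfolding dist_Pair_Pair using sqrt_sum_squares_le_sum[of "dist v w" "dist g c"]
            by (simp add: dist_commute)
          with True have "\<bar>F (v, g) - F (w, c)\<bar> < r / 2" by (intro d(2) g) simp
          moreover have "0 \<le> real k * ?D" by simp
          ultimately show ?thesis by linarith
        next
          case False
          have "2 * C \<le> real N * d" using N d(1) by (simp add: field_simps)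
          also have "\<dots> \<le> real k * ?D" using False k d(1) by (intro mult_mono) auto
          finally show ?thesis using C[of "(v,g)"] C[of "(w,c)"] r by linarith
        qed
      qed
      then show ?thesis using H_lower[of w k] r by auto
    qed
    then show "\<exists>no. \<forall>n\<ge>no. norm (H n w - F (w, c)) < r" by blast
  qed
  have "(\<lambda>k. \<integral>w. H k w \<partial>\<nu>) \<longlonglongrightarrow> (\<integral>w. F (w, c) \<partial>\<nu>)"
  proof (rule integral_dominated_convergence[where w = "\<lambda>_. C"])
    show "AE w in \<nu>. (\<lambda>k. H k w) \<longlonglongrightarrow> F (w, c)"
      using cont by eventually_elim (rule Hlim)
  qed (use Fnu Hmeas_nu H_bd in auto)
  then have "\<forall>\<^sub>F k in sequentially. (\<integral>w. H k w \<partial>\<nu>) < (\<integral>w. F (w, c) \<partial>\<nu>) + \<epsilon> / 4"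
    using eps by (intro order_tendstoD) auto
  then obtain k where k: "(\<integral>w. H k w \<partial>\<nu>) < (\<integral>w. F (w, c) \<partial>\<nu>) + \<epsilon> / 4"
    by (meson eventually_happens sequentially_bot)
  have "bounded (range (H k))"
    using H_bd by (auto simp: bounded_iff)
  then have "(\<lambda>n. \<integral>\<omega>. H k (W n \<omega>) \<partial>M n) \<longlonglongrightarrow> (\<integral>w. H k w \<partial>\<nu>)"
    using W(2) Hcont[of k] by (simp add: conv_in_law_def)
  then have ev1: "\<forall>\<^sub>F n in sequentially. (\<integral>\<omega>. H k (W n \<omega>) \<partial>M n) < (\<integral>w. H k w \<partial>\<nu>) + \<epsilon> / 4"
    using eps by (intro order_tendstoD) auto
  \<comment> \<open>Chosen after \<open>k\<close>, so that the penalty on the event of closeness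
    stays below a quarter of \<epsilon>; \<open>k + 1\<close> avoids division by zero. The other
    three quarters go to the envelope, the weak convergence and the exceptional event.\<close>
  define \<eta> where "\<eta> = \<epsilon> / (4 * (real k + 1))"
  have eta: "0 < \<eta>" using eps by (simp add: \<eta>_def)
  have keta: "real k * \<eta> \<le> \<epsilon> / 4" using eps by (simp add: \<eta>_def field_simps)
  let ?P = "\<lambda>n. measure (M n) {\<omega> \<in> space (M n). \<eta> \<le> norm (G n \<omega> - c)}"
  have "?P \<longlonglongrightarrow> 0" using G(2) eta by (simp add: conv_in_prob_def)
  then have "(\<lambda>n. 2 * C * ?P n) \<longlonglongrightarrow> 2 * C * 0" by (intro tendsto_intros)
  then have ev2: "\<forall>\<^sub>F n in sequentially. 2 * C * ?P n < \<epsilon> / 4"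
    using eps by (intro order_tendstoD) auto
  \<comment> \<open>On the exceptional event the crude bounds \<open>F \<le> C\<close> and
    \<open>- C \<le> H k\<close> cost at most \<open>2 * C\<close>.\<close>
  have main: "(\<integral>\<omega>. F (W n \<omega>, G n \<omega>) \<partial>M n) \<le> (\<integral>\<omega>. H k (W n \<omega>) \<partial>M n) + \<epsilon> / 4 + 2 * C * ?P n" for n
  proof -
    interpret Mn: prob_space "M n" by fact
    note [measurable] = G(1)[of n] W(1)[of n] FM[of n] Hmeas[of k]
    let ?E = "{\<omega> \<in> space (M n). \<eta> \<le> norm (G n \<omega> - c)}"
    have E[measurable]: "?E \<in> sets (M n)" by measurable
    have iH: "integrable (M n) (\<lambda>\<omega>. H k (W n \<omega>))"
      by (rule Mn.integrable_const_bound[of _ C]) (use H_bd in auto)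
    have iE: "integrable (M n) (\<lambda>\<omega>. indicator ?E \<omega> :: real)"
      by (rule Mn.integrable_const_bound[of _ 1]) auto
    have "(\<integral>\<omega>. F (W n \<omega>, G n \<omega>) \<partial>M n) \<le> (\<integral>\<omega>. H k (W n \<omega>) + \<epsilon> / 4 + 2 * C * indicator ?E \<omega> \<partial>M n)"
    proof (rule integral_mono)
      show "integrable (M n) (\<lambda>\<omega>. F (W n \<omega>, G n \<omega>))"
        by (rule Mn.integrable_const_bound[of _ C]) (use C in auto)
      show "integrable (M n) (\<lambda>\<omega>. H k (W n \<omega>) + \<epsilon> / 4 + 2 * C * indicator ?E \<omega>)"
        using iH iE by auto
      fix \<omega> assume w: "\<omega> \<in> space (M n)"
      show "F (W n \<omega>, G n \<omega>) \<le> H k (W n \<omega>) + \<epsilon> / 4 + 2 * C * indicator ?E \<omega>"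
      proof (cases "\<omega> \<in> ?E")
        case True
        then show ?thesis
          using C[of "(W n \<omega>, G n \<omega>)"] H_bd[of k "W n \<omega>"] eps by simp
      next
        case False
        then have "dist c (G n \<omega>) \<le> \<eta>" using w by (simp add: dist_norm norm_minus_commute)
        then have "real k * dist c (G n \<omega>) \<le> \<epsilon> / 4"
          using keta mult_left_mono[of "dist c (G n \<omega>)" \<eta> "real k"] by simp
        then show ?thesis using H_ge[OF S(2)[OF w], of "W n \<omega>" k "W n \<omega>"] False by simp
      qed
    qed
    also have "\<dots> = (\<integral>\<omega>. H k (W n \<omega>) \<partial>M n) + \<epsilon> / 4 + 2 * C * ?P n"
      using iH iE by (simp add: Mn.prob_space)
    finally show ?thesis .
  qed
  show ?thesis
    using ev1 ev2
  proof eventually_elim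
    case (elim n)
    then show ?case using main[of n] k by linarith
  qed
qed

text \<open>The one-sided bound applies to \<open>F\<close> and to \<open>- F\<close>. Measurability
  of \<open>F\<close> is asked for only along the sample and in the slice at \<open>c\<close>,
  because the intended \<open>F\<close> contains a weight selection that is not assumed jointly
  measurable.\<close>

lemma conv_in_law_prob_mapping:
  fixes F :: "'b::metric_space \<times> 'c::euclidean_space \<Rightarrow> real"
  assumes M: "\<And>n. prob_space (M n)" and nu: "prob_space \<nu>" "sets \<nu> = sets borel"
    and W: "\<And>n. W n \<in> borel_measurable (M n)" "conv_in_law M W \<nu>"
    and G: "\<And>n. G n \<in> borel_measurable (M n)" "conv_in_prob M G c"
    and S: "c \<in> S" "\<And>n \<omega>. \<omega> \<in> space (M n) \<Longrightarrow> G n \<omega> \<in> S"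
    and C: "\<And>p. \<bar>F p\<bar> \<le> C"
    and FM: "\<And>n. (\<lambda>\<omega>. F (W n \<omega>, G n \<omega>)) \<in> borel_measurable (M n)"
    and Fnu: "(\<lambda>w. F (w, c)) \<in> borel_measurable \<nu>"
    and cont: "AE w in \<nu>. continuous (at (w, c) within UNIV \<times> S) F"
  shows "(\<lambda>n. \<integral>\<omega>. F (W n \<omega>, G n \<omega>) \<partial>M n) \<longlonglongrightarrow> (\<integral>w. F (w, c) \<partial>\<nu>)"
proof (rule tendstoI)
  fix \<epsilon> :: real assume eps: "0 < \<epsilon>"
  have up: "\<forall>\<^sub>F n in sequentially. (\<integral>\<omega>. F (W n \<omega>, G n \<omega>) \<partial>M n) < (\<integral>w. F (w, c) \<partial>\<nu>) + \<epsilon>"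
    by (rule conv_in_law_prob_upper[OF M nu W G S C FM Fnu cont eps])
  have "\<forall>\<^sub>F n in sequentially. (\<integral>\<omega>. - F (W n \<omega>, G n \<omega>) \<partial>M n) < (\<integral>w. - F (w, c) \<partial>\<nu>) + \<epsilon>"
  proof (rule conv_in_law_prob_upper[OF M nu W G S])
    show "AE w in \<nu>. continuous (at (w, c) within UNIV \<times> S) (\<lambda>p. - F p)"
      using cont by eventually_elim (rule continuous_minus)
  qed (use C FM Fnu eps in auto)
  then show "\<forall>\<^sub>F n in sequentially. dist (\<integral>\<omega>. F (W n \<omega>, G n \<omega>) \<partial>M n) (\<integral>w. F (w, c) \<partial>\<nu>) < \<epsilon>"
    using up by eventually_elim (auto simp: dist_real_def)
qed

section \<open>Rotation invariance of the standard normal law\<close>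

no_notation Matrix.vec_index (infixl "$" 100)

lemma measurable_vec_lambda [measurable (raw)]:
  fixes f :: "'a \<Rightarrow> 'n::finite \<Rightarrow> real"
  assumes "\<And>i. (\<lambda>x. f x i) \<in> borel_measurable M"
  shows "(\<lambda>x. \<chi> i. f x i) \<in> borel_measurable M"
proof (subst borel_measurable_euclidean_space, intro ballI)
  fix b :: "real^'n" assume "b \<in> Basis"
  then obtain i where b: "b = axis i 1" by (auto simp: Basis_vec_def)
  show "(\<lambda>x. inner (\<chi> i. f x i) b) \<in> borel_measurable M"
    unfolding b inner_axis using assms[of i] by simp
qed

text \<open>Boxes determine Lebesgue measure, and the preimage of a box is a product of intervals.
  This turns densities over the index product into densities on Euclidean space.\<close>

lemma lborel_vec:
  "distr (PiM UNIV (\<lambda>_::'n::finite. lborel)) borel (\<lambda>z. \<chi> i. z i) = (lborel :: (real^'n) measure)"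
proof (rule lborel_eqI[symmetric])
  interpret product_sigma_finite "\<lambda>_::'n. lborel :: real measure" by standard
  fix l u :: "real^'n"
  assume le: "\<And>b. b \<in> Basis \<Longrightarrow> inner l b \<le> inner u b"
  have le': "l $ i \<le> u $ i" for i
    using le[of "axis i 1"] by (simp add: inner_axis)
  have [measurable]: "(\<lambda>z. \<chi> i. z i) \<in> borel_measurable (PiM UNIV (\<lambda>_::'n. lborel :: real measure))"
    by measurable
  have "(\<lambda>z. \<chi> i. z i) -` box l u \<inter> space (PiM UNIV (\<lambda>_::'n. lborel :: real measure))
      = PiE UNIV (\<lambda>i. {l $ i <..< u $ i})"
    by (auto simp: space_PiM mem_box_cart PiE_def Pi_iff)
  then have "emeasure (distr (PiM UNIV (\<lambda>_::'n. lborel)) borel (\<lambda>z. \<chi> i. z i)) (box l u)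
      = (\<Prod>i\<in>UNIV. emeasure lborel {l $ i <..< u $ i})"
    by (subst emeasure_distr) (auto simp: emeasure_PiM)
  also have "\<dots> = ennreal (\<Prod>i\<in>UNIV. u $ i - l $ i)"
    using le' by (simp add: prod_ennreal)
  also have "(\<Prod>i\<in>UNIV. u $ i - l $ i) = (\<Prod>b\<in>Basis. inner (u - l) b)"
  proof -
    have B: "(Basis :: (real^'n) set) = (\<lambda>i. axis i 1) ` UNIV"
      by (auto simp: Basis_vec_def)
    have "inj (\<lambda>i. axis i 1 :: real^'n)"
      by (auto simp: inj_on_def axis_eq_axis)
    then show ?thesis
      unfolding B by (subst prod.reindex) (auto simp: inner_axis)
  qed
  finally show "emeasure (distr (PiM UNIV (\<lambda>_::'n. lborel)) borel (\<lambda>z. \<chi> i. z i)) (box l u)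
      = ennreal (\<Prod>b\<in>Basis. inner (u - l) b)" .
qed simp

text \<open>Rectangles suffice: there the indicator factorises together with the density.\<close>

lemma PiM_std_normal:
  "PiM UNIV (\<lambda>_::'n::finite. std_normal_distribution)
     = density (PiM UNIV (\<lambda>_::'n. lborel)) (\<lambda>z. \<Prod>i\<in>UNIV. ennreal (std_normal_density (z i)))"
proof -
  interpret L: product_sigma_finite "\<lambda>_::'n. lborel :: real measure" by standard
  interpret N: product_sigma_finite "\<lambda>_::'n. std_normal_distribution"
    unfolding product_sigma_finite_def
    by (simp add: prob_space_imp_sigma_finite prob_space_normal_density)
  show ?thesis
  proof (rule N.PiM_eqI[symmetric])
    show "sets (density (PiM UNIV (\<lambda>_::'n. lborel)) (\<lambda>z. \<Prod>i\<in>UNIV. ennreal (std_normal_density (z i))))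
        = sets (PiM UNIV (\<lambda>_::'n. std_normal_distribution))"
      by (simp cong: sets_PiM_cong)
    fix A :: "'n \<Rightarrow> real set" assume "\<And>i. i \<in> UNIV \<Longrightarrow> A i \<in> sets std_normal_distribution"
    then have A[measurable]: "A i \<in> sets borel" for i by simp
    have PA: "PiE UNIV A \<in> sets (PiM UNIV (\<lambda>_::'n. lborel))"
      by (rule sets_PiM_I_finite) auto
    have ind: "indicator (PiE UNIV A) z = (\<Prod>i\<in>UNIV. indicator (A i) (z i) :: ennreal)" for z :: "'n \<Rightarrow> real"
    proof (cases "\<forall>i. z i \<in> A i")
      case True then show ?thesis by (simp add: PiE_def Pi_def)
    next
      case False
      then obtain j where "z j \<notin> A j" by blast
      then have "(\<Prod>i\<in>UNIV. indicator (A i) (z i) :: ennreal) = 0" by (intro prod_zero bexI[of _ j]) auto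
      with False show ?thesis by (auto simp: PiE_def Pi_def)
    qed
    have "emeasure (density (PiM UNIV (\<lambda>_::'n. lborel)) (\<lambda>z. \<Prod>i\<in>UNIV. ennreal (std_normal_density (z i)))) (PiE UNIV A)
        = (\<integral>\<^sup>+ z. (\<Prod>i\<in>UNIV. ennreal (std_normal_density (z i))) * indicator (PiE UNIV A) z \<partial>PiM UNIV (\<lambda>_::'n. lborel))"
      by (rule emeasure_density[OF _ PA]) measurable
    also have "\<dots> = (\<integral>\<^sup>+ z. (\<Prod>i\<in>UNIV. ennreal (std_normal_density (z i)) * indicator (A i) (z i)) \<partial>PiM UNIV (\<lambda>_::'n. lborel))"
      by (simp add: ind prod.distrib)
    also have "\<dots> = (\<Prod>i\<in>UNIV. \<integral>\<^sup>+ x. ennreal (std_normal_density x) * indicator (A i) x \<partial>lborel)"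
      by (rule L.product_nn_integral_prod) auto
    finally show "emeasure (density (PiM UNIV (\<lambda>_::'n. lborel)) (\<lambda>z. \<Prod>i\<in>UNIV. ennreal (std_normal_density (z i)))) (PiE UNIV A)
        = (\<Prod>i\<in>UNIV. emeasure std_normal_distribution (A i))"
      by (simp add: emeasure_density)
  qed simp
qed

definition std_normal_vec :: "(real^'n::finite) measure" where
  "std_normal_vec = distr (PiM UNIV (\<lambda>_. std_normal_distribution)) borel (\<lambda>z. \<chi> i. z i)"

lemma sets_std_normal_vec [simp, measurable_cong]: "sets std_normal_vec = sets borel"
  by (simp add: std_normal_vec_def)

text \<open>The point of this form is that the density depends on \<open>x\<close> only through
  \<open>inner x x\<close>, which orthogonal maps preserve.\<close>

lemma std_normal_vec_density:
  "(std_normal_vec :: (real^'n::finite) measure)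
     = density lborel (\<lambda>x. ennreal ((1 / sqrt (2 * pi)) ^ CARD('n) * exp (- inner x x / 2)))"
proof -
  have "(\<Prod>i\<in>UNIV. ennreal (std_normal_density (z i)))
      = ennreal ((1 / sqrt (2 * pi)) ^ CARD('n) * exp (- inner (\<chi> i. z i) ((\<chi> i. z i) :: real^'n) / 2))" for z :: "'n \<Rightarrow> real"
    by (simp add: prod_ennreal std_normal_density_def prod.distrib inner_vec_def power2_eq_square
        sum_negf sum_divide_distrib prod_dividef flip: exp_sum)
       (simp add: power_divide)
  then show ?thesis
    unfolding std_normal_vec_def PiM_std_normal
    by (subst lborel_vec[symmetric], subst density_distr) (simp_all, measurable)
qed

text \<open>The preimage of a box under \<open>U\<close> is its image under the transpose, whose
  determinant has absolute value 1.\<close>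

lemma lborel_orthogonal:
  fixes U :: "real^'n::{finite,wellorder}^'n::_"
  assumes U: "orthogonal_matrix U"
  shows "distr lborel borel ((*v) U) = lborel"
proof (rule lborel_eqI[symmetric])
  have UU: "U *v (Finite_Cartesian_Product.transpose U *v x) = x"
    "Finite_Cartesian_Product.transpose U *v (U *v x) = x" for x
    using U unfolding orthogonal_matrix_def
    by (simp_all add: matrix_vector_mul_assoc del: transpose_matrix_vector)
  have lin: "linear ((*v) (Finite_Cartesian_Product.transpose U))" by simp
  have mU [measurable]: "(*v) U \<in> borel_measurable borel"
    by (intro borel_measurable_continuous_onI linear_continuous_on linear_conv_bounded_linear[THEN iffD1]) simp
  fix l u :: "real^'n::_" assume le: "\<And>b. b \<in> Basis \<Longrightarrow> inner l b \<le> inner u b"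
  have "(*v) U -` box l u = (*v) (Finite_Cartesian_Product.transpose U) ` box l u"
  proof safe
    fix x assume "U *v x \<in> box l u"
    then show "x \<in> (*v) (Finite_Cartesian_Product.transpose U) ` box l u"
      by (rule rev_image_eqI) (rule UU(2)[symmetric])
  next
    fix x assume "x \<in> box l u"
    then show "Finite_Cartesian_Product.transpose U *v x \<in> (*v) U -` box l u"
      unfolding vimage_eq UU(1) .
  qed
  moreover have "(*v) U -` box l u \<in> sets borel"
    using measurable_sets_borel[OF mU, of "box l u"] by simp
  ultimately have "emeasure (distr lborel borel ((*v) U)) (box l u)
      = emeasure lebesgue ((*v) (Finite_Cartesian_Product.transpose U) ` box l u)"
    by (simp only: emeasure_distr mU measurable_lborel2 sets_lborel) (simp add: emeasure_distr)
  also have "\<dots> = ennreal (measure lebesgue ((*v) (Finite_Cartesian_Product.transpose U) ` box l u))"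
    using measurable_linear_image[OF lin, of "box l u"] by (intro emeasure_eq_measure2) auto
  also have "measure lebesgue ((*v) (Finite_Cartesian_Product.transpose U) ` box l u) = measure lebesgue (box l u)"
    using det_orthogonal_matrix[OF U] by (subst measure_linear_image[OF lin]) auto
  also have "\<dots> = (\<Prod>b\<in>Basis. inner (u - l) b)"
    using le by (simp add: measure_lborel_box_eq)
  finally show "emeasure (distr lborel borel ((*v) U)) (box l u) = ennreal (\<Prod>b\<in>Basis. inner (u - l) b)" .
qed simp

lemma std_normal_vec_orthogonal:
  fixes U :: "real^'n::{finite,wellorder}^'n::_"
  assumes U: "orthogonal_matrix U"
  shows "distr std_normal_vec borel ((*v) U) = std_normal_vec"
proof -
  have [measurable]: "(*v) U \<in> borel_measurable borel"
    by (intro borel_measurable_continuous_onI linear_continuous_on linear_conv_bounded_linear[THEN iffD1]) simp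
  have "inner (U *v x) (U *v x) = inner x x" for x
  proof -
    have "inner (U *v x) (U *v x) = inner (Finite_Cartesian_Product.transpose U *v (U *v x)) x"
      by (simp add: dot_lmul_matrix)
    also have "Finite_Cartesian_Product.transpose U *v (U *v x) = x"
      using U unfolding orthogonal_matrix_def
      by (simp add: matrix_vector_mul_assoc del: transpose_matrix_vector)
    finally show ?thesis .
  qed
  then show ?thesis
    unfolding std_normal_vec_density
    by (subst (2) lborel_orthogonal[OF U, symmetric]) (simp add: density_distr)
qed

lemma prob_space_std_normal: "prob_space std_normal_distribution"
  by (rule prob_space_normal_density) simp

text \<open>For \<open>s = 0\<close> the image is a point mass, matching the degenerate branch of
  \<open>normal_law\<close>; this covers a vanishing \<open>sigma_D\<close>.\<close>

lemma distr_std_normal_affine: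
  assumes "0 \<le> s"
  shows "distr std_normal_distribution borel (\<lambda>x. m + s * x) = normal_law m (s^2)"
proof (cases "s = 0")
  case True
  interpret prob_space std_normal_distribution by (rule prob_space_std_normal)
  show ?thesis using True by (simp add: normal_law_def distr_const)
next
  case False
  interpret prob_space std_normal_distribution by (rule prob_space_std_normal)
  have "distributed std_normal_distribution lborel (\<lambda>x. x) (normal_density 0 1)"
    by (simp add: distributed_def distr_id2)
  from normal_density_affine[OF this, of s m] False
  have "distributed std_normal_distribution lborel (\<lambda>x. m + s * x) (normal_density m \<bar>s\<bar>)" by simp
  then have "distr std_normal_distribution lborel (\<lambda>x. m + s * x) = density lborel (normal_density m \<bar>s\<bar>)"
    by (simp add: distributed_def)
  then show ?thesis using False assms by (simp add: normal_law_def cong: distr_cong)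
qed

lemma sets_normal_law [simp, measurable_cong]: "sets (normal_law m v) = sets borel"
  by (simp add: normal_law_def)

lemma prob_space_normal_law: "0 \<le> v \<Longrightarrow> prob_space (normal_law m v)"
  using prob_space.prob_space_distr[OF prob_space_std_normal, of "\<lambda>x. m + sqrt v * x" borel]
    distr_std_normal_affine[of "sqrt v" m] by simp

lemma sets_normal_pair [measurable_cong]: "sets (normal_pair m1 m2) = sets (borel \<Otimes>\<^sub>M borel)"
  unfolding normal_pair_def by (intro sets_pair_measure_cong) simp_all

lemma prob_space_normal_pair: "prob_space (normal_pair m1 m2)"
  unfolding normal_pair_def
  by (intro prob_space_pair prob_space_normal_law) simp_all

lemma sets_PiM_std_normal: "sets (PiM I (\<lambda>_. std_normal_distribution)) = sets (PiM I (\<lambda>_. borel))"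
  by (rule sets_PiM_cong) auto

text \<open>The third coordinate is put first because it will carry \<open>D\<close>, while the
  other two form the noise pair.\<close>

lemma distr_PiM_3:
  "distr (PiM (UNIV::3 set) (\<lambda>_. std_normal_distribution)) (borel \<Otimes>\<^sub>M (borel \<Otimes>\<^sub>M borel)) (\<lambda>z. (z 3, z 1, z 2))
     = std_normal_distribution \<Otimes>\<^sub>M (std_normal_distribution \<Otimes>\<^sub>M std_normal_distribution)"
proof (rule measure_eqI)
  let ?s = "std_normal_distribution"
  interpret S: prob_space ?s by (rule prob_space_std_normal)
  interpret SS: pair_prob_space ?s ?s by standard
  interpret SSS: pair_prob_space ?s "?s \<Otimes>\<^sub>M ?s" by standard
  interpret N: product_sigma_finite "\<lambda>_::3. ?s"
    unfolding product_sigma_finite_def by (simp add: S.sigma_finite_measure_axioms)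
  note sets_PiM_std_normal[measurable_cong]
  show "sets (distr (PiM (UNIV::3 set) (\<lambda>_. ?s)) (borel \<Otimes>\<^sub>M (borel \<Otimes>\<^sub>M borel)) (\<lambda>z. (z 3, z 1, z 2)))
      = sets (?s \<Otimes>\<^sub>M (?s \<Otimes>\<^sub>M ?s))"
    unfolding sets_distr by (intro sets_pair_measure_cong) simp_all
  fix A assume "A \<in> sets (distr (PiM (UNIV::3 set) (\<lambda>_. ?s)) (borel \<Otimes>\<^sub>M (borel \<Otimes>\<^sub>M borel)) (\<lambda>z. (z 3, z 1, z 2)))"
  then have A[measurable]: "A \<in> sets (borel \<Otimes>\<^sub>M (borel \<Otimes>\<^sub>M borel))" by simp
  let ?f = "\<lambda>z::3 \<Rightarrow> real. indicator A (z 3, z 1, z 2) :: ennreal"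
  \<comment> \<open>Nested insertions let the coordinates be integrated out one at a time, in the
    order of the target triple.\<close>
  have U: "(UNIV::3 set) = insert 3 (insert 1 {2})"
    using UNIV_3 by auto
  have "emeasure (distr (PiM (UNIV::3 set) (\<lambda>_. ?s)) (borel \<Otimes>\<^sub>M (borel \<Otimes>\<^sub>M borel)) (\<lambda>z. (z 3, z 1, z 2))) A
      = (\<integral>\<^sup>+ z. ?f z \<partial>PiM (UNIV::3 set) (\<lambda>_. ?s))"
    by (subst nn_integral_indicator[symmetric], simp, subst nn_integral_distr) simp_all
  also have "\<dots> = (\<integral>\<^sup>+ x. \<integral>\<^sup>+ y. ?f (y(3 := x)) \<partial>PiM (insert (1::3) {2}) (\<lambda>_. ?s) \<partial>?s)"
    unfolding U by (rule N.product_nn_integral_insert_rev) (simp_all, measurable)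
  also have "\<dots> = (\<integral>\<^sup>+ x. \<integral>\<^sup>+ x'. \<integral>\<^sup>+ y. indicator A (x, x', y 2) \<partial>PiM {2::3} (\<lambda>_. ?s) \<partial>?s \<partial>?s)"
    by (subst N.product_nn_integral_insert_rev) (simp_all, measurable)
  also have "\<dots> = (\<integral>\<^sup>+ x. \<integral>\<^sup>+ x'. \<integral>\<^sup>+ x''. indicator A (x, x', x'') \<partial>?s \<partial>?s \<partial>?s)"
    by (subst N.product_nn_integral_singleton) (simp_all, measurable)
  also have "\<dots> = (\<integral>\<^sup>+ x. \<integral>\<^sup>+ q. indicator A (x, q) \<partial>(?s \<Otimes>\<^sub>M ?s) \<partial>?s)"
    by (subst S.nn_integral_fst[symmetric]) (simp_all, measurable)
  also have "\<dots> = (\<integral>\<^sup>+ p. indicator A p \<partial>(?s \<Otimes>\<^sub>M (?s \<Otimes>\<^sub>M ?s)))"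
    by (subst SS.nn_integral_fst[symmetric]) (simp_all, measurable)
  finally show "emeasure (distr (PiM (UNIV::3 set) (\<lambda>_. ?s)) (borel \<Otimes>\<^sub>M (borel \<Otimes>\<^sub>M borel)) (\<lambda>z. (z 3, z 1, z 2))) A
      = emeasure (?s \<Otimes>\<^sub>M (?s \<Otimes>\<^sub>M ?s)) A"
    by simp
qed

lemma distr_std_normal_vec_diag:
  assumes "0 \<le> s"
  shows "distr std_normal_vec (borel \<Otimes>\<^sub>M (borel \<Otimes>\<^sub>M borel))
      (\<lambda>z::real^3. (m3 + s * z $ 3, m1 + z $ 1, m2 + z $ 2))
     = normal_law m3 (s^2) \<Otimes>\<^sub>M normal_pair m1 m2"
proof -
  let ?s = "std_normal_distribution"
  note sets_PiM_std_normal[measurable_cong]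
  have ps: "prob_space (distr ?s borel (\<lambda>x. m + c * x))" for m c
    by (rule prob_space.prob_space_distr[OF prob_space_std_normal]) simp
  \<comment> \<open>The factor \<open>1 *\<close> keeps both marginals in the affine shape of
    \<open>distr_std_normal_affine\<close>.\<close>
  have *: "distr ?s borel (\<lambda>x. m1 + 1 * x) \<Otimes>\<^sub>M distr ?s borel (\<lambda>x. m2 + 1 * x)
      = distr (?s \<Otimes>\<^sub>M ?s) (borel \<Otimes>\<^sub>M borel) (\<lambda>(x, y). (m1 + 1 * x, m2 + 1 * y))"
    by (intro pair_measure_distr prob_space_imp_sigma_finite ps) simp_all
  have "normal_law m3 (s^2) \<Otimes>\<^sub>M normal_pair m1 m2
      = distr ?s borel (\<lambda>x. m3 + s * x) \<Otimes>\<^sub>M distr (?s \<Otimes>\<^sub>M ?s) (borel \<Otimes>\<^sub>M borel) (\<lambda>(x, y). (m1 + 1 * x, m2 + 1 * y))"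
    unfolding *[symmetric] using assms
    by (simp only: distr_std_normal_affine zero_le_one normal_pair_def one_power2)
  also have "\<dots> = distr (?s \<Otimes>\<^sub>M (?s \<Otimes>\<^sub>M ?s)) (borel \<Otimes>\<^sub>M (borel \<Otimes>\<^sub>M borel))
      (\<lambda>(x, q). (m3 + s * x, (case q of (x, y) \<Rightarrow> (m1 + 1 * x, m2 + 1 * y))))"
  proof (rule pair_measure_distr)
    show "sigma_finite_measure (distr (?s \<Otimes>\<^sub>M ?s) (borel \<Otimes>\<^sub>M borel) (\<lambda>(x, y). (m1 + 1 * x, m2 + 1 * y)))"
      unfolding *[symmetric] by (intro prob_space_imp_sigma_finite prob_space_pair ps)
  qed simp_all
  also have "\<dots> = distr (PiM (UNIV::3 set) (\<lambda>_. ?s)) (borel \<Otimes>\<^sub>M (borel \<Otimes>\<^sub>M borel))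
      (\<lambda>z. (m3 + s * z 3, m1 + z 1, m2 + z 2))"
    unfolding distr_PiM_3[symmetric] by (subst distr_distr) (simp_all add: comp_def)
  also have "\<dots> = distr std_normal_vec (borel \<Otimes>\<^sub>M (borel \<Otimes>\<^sub>M borel))
      (\<lambda>z::real^3. (m3 + s * z $ 3, m1 + z $ 1, m2 + z $ 2))"
    unfolding std_normal_vec_def by (subst distr_distr) (simp_all add: comp_def)
  finally show ?thesis ..
qed

text \<open>For \<open>s = 0\<close> the third vector vanishes and its direction is supplied by the cross product.\<close>
lemma orthonormal_completion:
  fixes t1 t2 t3 :: "real^3"
  assumes t: "inner t1 t1 = 1" "inner t2 t2 = 1" "inner t1 t2 = 0" "inner t3 t1 = 0" "inner t3 t2 = 0"
    "inner t3 t3 = s^2" and s: "0 \<le> s"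
  obtains o3 where "inner o3 o3 = 1" "inner o3 t1 = 0" "inner o3 t2 = 0" "t3 = s *\<^sub>R o3"
proof (cases "s = 0")
  case True
  then have "t3 = 0" using t by simp
  moreover have "inner (cross3 t1 t2) (cross3 t1 t2) = 1"
    using norm_cross[of t1 t2] t by (simp add: power2_norm_eq_inner)
  ultimately show ?thesis using True that[of "cross3 t1 t2"]
    by (simp add: dot_cross_self inner_commute)
next
  case False
  then show ?thesis using t by (intro that[of "t3 /\<^sub>R s"]) (simp_all add: power2_eq_square field_simps)
qed

lemma distr_std_normal_vec_linear:
  fixes t1 t2 t3 :: "real^3"
  assumes t: "inner t1 t1 = 1" "inner t2 t2 = 1" "inner t1 t2 = 0" "inner t3 t1 = 0" "inner t3 t2 = 0"
    "inner t3 t3 = s^2" and s: "0 \<le> s"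
  shows "distr std_normal_vec (borel \<Otimes>\<^sub>M (borel \<Otimes>\<^sub>M borel))
      (\<lambda>z. (m3 + inner t3 z, m1 + inner t1 z, m2 + inner t2 z))
     = normal_law m3 (s^2) \<Otimes>\<^sub>M normal_pair m1 m2"
proof -
  obtain o3 where o: "inner o3 o3 = 1" "inner o3 t1 = 0" "inner o3 t2 = 0" "t3 = s *\<^sub>R o3"
    using orthonormal_completion[OF t s] .
  \<comment> \<open>The rows form an orthonormal basis; \<open>s\<close> times the third coordinate
    of \<open>U *v z\<close> recovers \<open>inner t3 z\<close>, also when
    \<open>s = 0\<close>.\<close>
  define U :: "real^3^3" where "U = vector [t1, t2, o3]"
  have rows: "Finite_Cartesian_Product.row 1 U = t1" "Finite_Cartesian_Product.row 2 U = t2" "Finite_Cartesian_Product.row 3 U = o3"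
    by (simp_all add: U_def Finite_Cartesian_Product.row_def)
  have U: "orthogonal_matrix U"
    unfolding orthogonal_matrix_orthonormal_rows forall_3 rows
    using t o by (simp add: norm_eq_1 real_inner_class.orthogonal_def inner_commute)
  have comp: "(U *v z) $ 1 = inner t1 z" "(U *v z) $ 2 = inner t2 z" "(U *v z) $ 3 = inner o3 z" for z
    by (simp_all add: matrix_vector_mul_component U_def)
  have [measurable]: "(*v) U \<in> borel_measurable borel"
    by (intro borel_measurable_continuous_onI linear_continuous_on linear_conv_bounded_linear[THEN iffD1]) simp
  have [measurable]: "(\<lambda>z::real^3. z $ i) \<in> borel_measurable borel" for i
    by (intro borel_measurable_continuous_onI continuous_intros)
  have "normal_law m3 (s^2) \<Otimes>\<^sub>M normal_pair m1 m2
      = distr (distr std_normal_vec borel ((*v) U)) (borel \<Otimes>\<^sub>M (borel \<Otimes>\<^sub>M borel))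
          (\<lambda>z::real^3. (m3 + s * z $ 3, m1 + z $ 1, m2 + z $ 2))"
    unfolding std_normal_vec_orthogonal[OF U] by (rule distr_std_normal_vec_diag[OF s, symmetric])
  also have "\<dots> = distr std_normal_vec (borel \<Otimes>\<^sub>M (borel \<Otimes>\<^sub>M borel))
      (\<lambda>z. (m3 + inner t3 z, m1 + inner t1 z, m2 + inner t2 z))"
    by (subst distr_distr) (simp_all add: comp_def comp o)
  finally show ?thesis ..
qed

section \<open>The distribution of the weighted statistic\<close>

text \<open>Monotonicity and right-continuity make \<open>{x. p \<le> cdf \<nu> x}\<close> a closed
  upper half-line, nonempty and bounded below because \<open>0 < p < 1\<close>; its infimum is thus
  attained.\<close>

lemma quantile_le_iff:
  assumes "real_distribution \<nu>" and p: "0 < p" "p < 1"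
  shows "quantile \<nu> p \<le> x \<longleftrightarrow> p \<le> cdf \<nu> x"
proof -
  interpret real_distribution \<nu> by fact
  have "\<forall>\<^sub>F y in at_bot. cdf \<nu> y < p"
    using order_tendstoD(2)[OF cdf_lim_at_bot] p by auto
  then obtain y0 where y0: "cdf \<nu> y0 < p"
    unfolding eventually_at_bot_linorder by blast
  have bdd: "bdd_below {x. p \<le> cdf \<nu> x}"
  proof (rule bdd_belowI)
    fix x assume "x \<in> {x. p \<le> cdf \<nu> x}"
    then show "y0 \<le> x" using y0 cdf_nondecreasing[of x y0] by (cases "y0 \<le> x") auto
  qed
  have "\<forall>\<^sub>F y in at_top. p < cdf \<nu> y"
    using order_tendstoD(1)[OF cdf_lim_at_top_prob] p by auto
  then obtain y1 where y1: "p < cdf \<nu> y1"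
    unfolding eventually_at_top_linorder by blast
  show ?thesis
  proof
    assume "p \<le> cdf \<nu> x"
    then show "quantile \<nu> p \<le> x" unfolding quantile_def by (intro cInf_lower bdd) simp
  next
    assume le: "quantile \<nu> p \<le> x"
    show "p \<le> cdf \<nu> x"
    proof (rule ccontr)
      assume "\<not> p \<le> cdf \<nu> x"
      then have "\<forall>\<^sub>F y in at_right x. cdf \<nu> y < p"
        using cdf_is_right_cont[of x] by (intro order_tendstoD(2)) (auto simp: continuous_within)
      then obtain b where b: "x < b" "\<And>y. x < y \<Longrightarrow> y < b \<Longrightarrow> cdf \<nu> y < p"
        unfolding eventually_at_right_field by blast
      \<comment> \<open>By right-continuity the distribution function stays below \<open>p\<close>
        just beyond \<open>x\<close>; the midpoint is a lower bound of the half-line that lies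
        strictly above \<open>x\<close>.\<close>
      have "(x + b) / 2 \<le> quantile \<nu> p"
        unfolding quantile_def
      proof (rule cInf_greatest)
        show "{x. p \<le> cdf \<nu> x} \<noteq> {}" using y1 by (auto intro: less_imp_le)
        fix y assume "y \<in> {x. p \<le> cdf \<nu> x}"
        then have y: "p \<le> cdf \<nu> y" by simp
        have "cdf \<nu> ((x + b) / 2) < p" using b by simp
        then show "(x + b) / 2 \<le> y"
          using y cdf_nondecreasing[of y "(x + b) / 2"] by (cases "(x + b) / 2 \<le> y") auto
      qed
      then show False using le b(1) by simp
    qed
  qed
qed

text \<open>The level set lies between its infimum and its supremum, where the distribution function
  takes the same value \<open>p\<close>. The half-open interval between them has mass
  \<open>p - p = 0\<close>, and the left endpoint is no atom.\<close>

lemma AE_cdf_neq: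
  assumes "real_distribution \<nu>" and p: "0 < p" "p < 1"
    and atomless: "\<And>x. measure \<nu> {x} = 0"
  shows "AE x in \<nu>. cdf \<nu> x \<noteq> p"
proof -
  interpret real_distribution \<nu> by fact
  let ?I = "{x. cdf \<nu> x = p}"
  have cont: "continuous_on UNIV (cdf \<nu>)"
    using atomless by (simp add: continuous_at_imp_continuous_on isCont_cdf)
  have closed: "closed ?I"
    using continuous_closed_preimage_constant[OF cont closed_UNIV, of p] by simp
  have "\<forall>\<^sub>F y in at_bot. cdf \<nu> y < p" "\<forall>\<^sub>F y in at_top. p < cdf \<nu> y"
    using order_tendstoD(2)[OF cdf_lim_at_bot] order_tendstoD(1)[OF cdf_lim_at_top_prob] p by auto
  then obtain u v where uv: "\<And>y. y \<le> u \<Longrightarrow> cdf \<nu> y < p" "\<And>y. v \<le> y \<Longrightarrow> p < cdf \<nu> y"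
    unfolding eventually_at_bot_linorder eventually_at_top_linorder by blast
  have "?I \<subseteq> {u..v}"
    using uv by (auto simp: not_le[symmetric]) (metis less_irrefl linear)+
  then have bdd: "bdd_below ?I" "bdd_above ?I"
    by (meson bdd_below_mono bdd_below_Icc, meson bdd_above_mono bdd_above_Icc)
  have "?I \<in> null_sets \<nu>"
  proof (cases "?I = {}")
    case False
    have i: "Inf ?I \<in> ?I" and s: "Sup ?I \<in> ?I"
      using closed_contains_Inf[OF False bdd(1) closed] closed_contains_Sup[OF False bdd(2) closed] by auto
    have le: "Inf ?I \<le> Sup ?I" using i bdd by (intro cSup_upper)
    have "?I \<subseteq> {Inf ?I} \<union> {Inf ?I <.. Sup ?I}"
      using cInf_lower[OF _ bdd(1)] cSup_upper[OF _ bdd(2)] by force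
    moreover have "{Inf ?I} \<in> null_sets \<nu>" "{Inf ?I <.. Sup ?I} \<in> null_sets \<nu>"
      using atomless emeasure_Ioc[OF le] i s by (auto simp: emeasure_eq_measure null_sets_def)
    moreover have "?I \<in> sets \<nu>" using closed by simp
    ultimately show ?thesis by (meson null_sets.Un null_sets_subset)
  qed simp
  then show ?thesis by (rule AE_I'[of ?I]) auto
qed

lemma measurable_clc_stat [measurable (raw)]:
  assumes [measurable]: "f \<in> borel_measurable N" "g \<in> borel_measurable N"
    "h1 \<in> borel_measurable N" "h2 \<in> borel_measurable N"
  shows "(\<lambda>x. clc_stat (f x) (g x) (h1 x, h2 x)) \<in> borel_measurable N"
proof -
  have [measurable]: "(\<lambda>x. fst (f x)) \<in> borel_measurable N" "(\<lambda>x. snd (f x)) \<in> borel_measurable N"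
    using assms(1) by (simp_all add: borel_measurable_Pair borel_prod[symmetric])
  show ?thesis unfolding clc_stat_def by simp
qed

lemma normal_pair_0: "normal_pair 0 0 = std_normal_distribution \<Otimes>\<^sub>M std_normal_distribution"
  by (simp add: normal_pair_def normal_law_def)

text \<open>This is the function \<open>F\<close> of the overview. It is written with
  \<open>normal_pair 0 0\<close> so that facts about normal pairs with arbitrary means apply to it
  directly.\<close>

definition clc_cdf :: "real \<times> real \<Rightarrow> real \<Rightarrow> real \<Rightarrow> real" where
  "clc_cdf a \<rho> x = measure (normal_pair 0 0) {z. clc_stat a \<rho> z \<le> x}"

lemma space_normal_pair [simp]: "space (normal_pair m1 m2) = UNIV"
  using sets_eq_imp_space_eq[OF sets_normal_pair] by (simp add: space_pair_measure)

lemma clc_stat_pair_measurable: "clc_stat a \<rho> \<in> borel_measurable (normal_pair m1 m2)"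
proof -
  have "(\<lambda>z. clc_stat a \<rho> (fst z, snd z)) \<in> borel_measurable (borel \<Otimes>\<^sub>M borel)"
    by measurable
  then show ?thesis by (simp cong: measurable_cong_sets[OF sets_normal_pair refl])
qed

text \<open>The measure of a section of a jointly measurable set is a measurable function of the
  parameter.\<close>

lemma measurable_clc_cdf:
  assumes [measurable]: "f \<in> borel_measurable N" "g \<in> borel_measurable N" "h \<in> borel_measurable N"
  shows "(\<lambda>x. clc_cdf (f x) (g x) (h x)) \<in> borel_measurable N"
proof -
  interpret prob_space "normal_pair 0 0" by (rule prob_space_normal_pair)
  note sets_normal_pair[measurable_cong]
  have "{x \<in> space (N \<Otimes>\<^sub>M normal_pair 0 0).
      clc_stat (f (fst x)) (g (fst x)) (fst (snd x), snd (snd x)) \<le> h (fst x)} \<in> sets (N \<Otimes>\<^sub>M normal_pair 0 0)"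
    by measurable
  then show ?thesis
    unfolding clc_cdf_def by (intro measurable_measure) auto
qed

lemma clc_distr_real_distribution:
  "real_distribution (distr (normal_pair 0 0) borel (clc_stat a \<rho>))"
  by (rule prob_space.real_distribution_distr[OF prob_space_normal_pair clc_stat_pair_measurable])

lemma cdf_clc_distr: "cdf (distr (normal_pair 0 0) borel (clc_stat a \<rho>)) x = clc_cdf a \<rho> x"
  unfolding cdf_def clc_cdf_def
  by (subst measure_distr) (auto intro!: clc_stat_pair_measurable arg_cong[where f = "measure _"])

lemma crit_le_iff:
  assumes "0 < \<alpha>" "\<alpha> < 1"
  shows "crit \<alpha> a \<rho> \<le> x \<longleftrightarrow> 1 - \<alpha> \<le> clc_cdf a \<rho> x"
  using quantile_le_iff[OF clc_distr_real_distribution, of "1 - \<alpha>" a \<rho> x] assms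
  by (simp add: crit_def normal_pair_0[symmetric] cdf_clc_distr)

text \<open>The joint density is strictly positive, so the null sets are those of Lebesgue measure,
  whatever the means.\<close>

lemma AE_normal_pair_iff:
  assumes P: "{z. P z} \<in> sets (borel \<Otimes>\<^sub>M borel)"
  shows "(AE z in normal_pair m1 m2. P z) \<longleftrightarrow> (AE z in lborel \<Otimes>\<^sub>M lborel. P z)"
proof -
  have "sigma_finite_measure (density lborel (normal_density m 1))" for m
    by (intro prob_space_imp_sigma_finite prob_space_normal_density) simp
  then have eq: "normal_pair m1 m2 = density (lborel \<Otimes>\<^sub>M lborel)
      (\<lambda>(x, y). ennreal (normal_density m1 1 x) * ennreal (normal_density m2 1 y))"
    unfolding normal_pair_def normal_law_def
    by (simp add: pair_measure_density lborel.sigma_finite_measure_axioms)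
  moreover have "(\<lambda>(x, y). ennreal (normal_density m1 1 x) * ennreal (normal_density m2 1 y))
      \<in> borel_measurable (lborel \<Otimes>\<^sub>M lborel)"
    by measurable
  moreover have "0 < ennreal (normal_density m1 1 x) * ennreal (normal_density m2 1 y)" for x y
    by (simp add: normal_density_pos ennreal_zero_less_mult_iff)
  ultimately show ?thesis
    unfolding eq by (subst AE_density) (auto simp: split_beta')
qed

text \<open>For a fixed first coordinate the statistic is a polynomial of degree two in the second,
  so it takes the value \<open>x\<close> at no more than finitely many points; Fubini does the
  rest.\<close>

lemma AE_clc_stat_neq:
  assumes a: "a \<in> A0 abar" and abar: "abar < 1" and rho: "\<bar>\<rho>\<bar> < 1"
  shows "AE z in normal_pair m1 m2. clc_stat a \<rho> z \<noteq> x"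
proof -
  have 1: "{z. clc_stat a \<rho> z \<noteq> x} \<in> sets (borel \<Otimes>\<^sub>M borel)"
    using borel_measurable_neq[OF clc_stat_pair_measurable[of a \<rho> 0 0] borel_measurable_const[of x]]
    by (simp add: sets_normal_pair)
  show ?thesis
    unfolding AE_normal_pair_iff[OF 1]
  proof (rule lborel_pair.AE_pair_measure)
    show "{z \<in> space (lborel \<Otimes>\<^sub>M lborel). clc_stat a \<rho> z \<noteq> x} \<in> sets (lborel \<Otimes>\<^sub>M lborel)"
      using 1 by (simp add: space_pair_measure cong: sets_pair_measure_cong)
    have "AE y in lborel. clc_stat a \<rho> (u, y) \<noteq> x" for u
    proof -
      \<comment> \<open>The coefficients of that polynomial. The leading one is positive: its first
        summand is nonnegative and the second is at least \<open>1 - abar\<close>.\<close>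
      let ?A = "snd a * (1 - \<rho>^2) + (1 - fst a - snd a)"
      let ?B = "2 * snd a * \<rho> * u * sqrt (1 - \<rho>^2)"
      let ?C = "(fst a + snd a * \<rho>^2) * u^2 - x"
      have r: "\<rho>^2 < 1" using rho by (simp add: abs_square_less_1)
      have "0 \<le> snd a * (1 - \<rho>^2)" "0 < 1 - fst a - snd a"
        using a abar r by (auto simp: A0_def split_beta)
      then have A: "?A \<noteq> 0" by linarith
      have sq: "sqrt (1 - \<rho>^2) * sqrt (1 - \<rho>^2) = 1 - \<rho>^2" using r by simp
      have eq: "clc_stat a \<rho> (u, y) - x = ?A * y^2 + ?B * y + ?C" for y
      proof -
        have "clc_stat a \<rho> (u, y) - x
          = fst a * u^2 + snd a * (\<rho>^2 * u^2 + 2 * \<rho> * u * sqrt (1 - \<rho>^2) * y + (sqrt (1 - \<rho>^2) * sqrt (1 - \<rho>^2)) * y^2)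
            + (1 - fst a - snd a) * y^2 - x"
          by (simp add: clc_stat_def power2_eq_square algebra_simps)
        then show ?thesis unfolding sq by (simp add: power2_eq_square algebra_simps)
      qed
      have "poly [:?C, ?B, ?A:] y = ?A * y^2 + ?B * y + ?C" for y
        by (simp add: power2_eq_square algebra_simps)
      then have "{y. clc_stat a \<rho> (u, y) = x} = {y. poly [:?C, ?B, ?A:] y = 0}"
        using eq by (metis eq_iff_diff_eq_0)
      moreover have "finite {y. poly [:?C, ?B, ?A:] y = 0}"
        by (rule poly_roots_finite) (use A in simp)
      ultimately have "{y. clc_stat a \<rho> (u, y) = x} \<in> null_sets lborel"
        by (simp add: finite_imp_null_set_lborel)
      then show ?thesis by (rule AE_I') auto
    qed
    then show "AE u in lborel. AE y in lborel. clc_stat a \<rho> (u, y) \<noteq> x" by simp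
  qed
qed

lemma clc_distr_atomless:
  assumes "a \<in> A0 abar" "abar < 1" "\<bar>\<rho>\<bar> < 1"
  shows "measure (distr (normal_pair 0 0) borel (clc_stat a \<rho>)) {x} = 0"
proof -
  have "measure (normal_pair 0 0) {z. clc_stat a \<rho> z = x} = 0"
    using AE_clc_stat_neq[OF assms, of x 0 0]
    using measurable_sets[OF clc_stat_pair_measurable[of a \<rho> 0 0], of "{x}"]
    by (subst (asm) AE_iff_measurable[OF _ refl]) (simp_all add: measure_def vimage_def)
  then show ?thesis
    by (subst measure_distr) (auto intro!: clc_stat_pair_measurable simp: vimage_def)
qed

text \<open>At mean zero \<open>clc_cdf a \<rho>\<close> is the distribution function of the
  statistic itself, so \<open>AE_cdf_neq\<close> applies; equality of null sets carries the result
  to arbitrary means.\<close>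

lemma AE_clc_cdf_neq:
  assumes a: "a \<in> A0 abar" and abar: "abar < 1" and rho: "\<bar>\<rho>\<bar> < 1" and p: "0 < p" "p < 1"
  shows "AE z in normal_pair m1 m2. clc_cdf a \<rho> (clc_stat a \<rho> z) \<noteq> p"
proof -
  note [measurable] = clc_stat_pair_measurable
  have m: "(\<lambda>z. clc_cdf a \<rho> (clc_stat a \<rho> z)) \<in> borel_measurable (normal_pair 0 0)"
    by (intro measurable_clc_cdf) measurable
  have 1: "{z. clc_cdf a \<rho> (clc_stat a \<rho> z) \<noteq> p} \<in> sets (borel \<Otimes>\<^sub>M borel)"
    using borel_measurable_neq[OF m, of "\<lambda>_. p"] by (simp add: sets_normal_pair)
  have "AE x in distr (normal_pair 0 0) borel (clc_stat a \<rho>). clc_cdf a \<rho> x \<noteq> p"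
    using AE_cdf_neq[OF clc_distr_real_distribution p clc_distr_atomless[OF a abar rho]]
    by (simp add: cdf_clc_distr)
  moreover have "(\<lambda>x. clc_cdf a \<rho> x) \<in> borel_measurable borel"
    by (intro measurable_clc_cdf) measurable
  ultimately have "AE z in normal_pair 0 0. clc_cdf a \<rho> (clc_stat a \<rho> z) \<noteq> p"
    by (subst (asm) AE_distr_iff) (auto simp: clc_stat_pair_measurable)
  then show ?thesis unfolding AE_normal_pair_iff[OF 1] .
qed

text \<open>Dominated convergence: the indicators converge except where the statistic equals
  \<open>x\<close>, a null set. The restrictions concern the limit point; the approaching parameters
  are arbitrary.\<close>

lemma isCont_clc_cdf:
  assumes a: "a \<in> A0 abar" and abar: "abar < 1" and rho: "\<bar>\<rho>\<bar> < 1"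
  shows "isCont (\<lambda>(a, \<rho>, x). clc_cdf a \<rho> x) (a, \<rho>, x)"
  unfolding continuous_at_sequentially
proof safe
  fix X :: "nat \<Rightarrow> (real \<times> real) \<times> real \<times> real" assume X: "X \<longlonglongrightarrow> (a, \<rho>, x)"
  interpret prob_space "normal_pair 0 0" by (rule prob_space_normal_pair)
  define an where "an n = fst (X n)" for n
  define rn where "rn n = fst (snd (X n))" for n
  define xn where "xn n = snd (snd (X n))" for n
  have an: "an \<longlonglongrightarrow> a" and rn: "rn \<longlonglongrightarrow> \<rho>" and xn: "xn \<longlonglongrightarrow> x"
    using tendsto_fst[OF X] tendsto_fst[OF tendsto_snd[OF X]] tendsto_snd[OF tendsto_snd[OF X]]
    by (simp_all add: an_def[abs_def] rn_def[abs_def] xn_def[abs_def])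
  have m: "{z. clc_stat a \<rho> z \<le> x} \<in> sets (normal_pair 0 0)" for a \<rho> x
    using borel_measurable_le[OF clc_stat_pair_measurable[of a \<rho> 0 0] borel_measurable_const[of x]] by simp
  have cdf_eq: "clc_cdf a \<rho> x = (\<integral>z. indicator {z. clc_stat a \<rho> z \<le> x} z \<partial>normal_pair 0 0)" for a \<rho> x
    using m by (simp add: clc_cdf_def)
  have "(\<lambda>n. \<integral>z. indicator {z. clc_stat (an n) (rn n) z \<le> xn n} z \<partial>normal_pair 0 0)
      \<longlonglongrightarrow> (\<integral>z. indicator {z. clc_stat a \<rho> z \<le> x} z \<partial>normal_pair 0 0 :: real)"
  proof (rule integral_dominated_convergence[where w = "\<lambda>_. 1"])
    show "AE z in normal_pair 0 0. (\<lambda>n. indicator {z. clc_stat (an n) (rn n) z \<le> xn n} z)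
        \<longlonglongrightarrow> (indicator {z. clc_stat a \<rho> z \<le> x} z :: real)"
      using AE_clc_stat_neq[OF assms, of x 0 0]
    proof eventually_elim
      case (elim z)
      have lim: "(\<lambda>n. clc_stat (an n) (rn n) z - xn n) \<longlonglongrightarrow> clc_stat a \<rho> z - x"
        unfolding clc_stat_def by (intro tendsto_intros an rn xn)
      show ?case
      proof (cases "clc_stat a \<rho> z < x")
        case True
        then have "\<forall>\<^sub>F n in sequentially. clc_stat (an n) (rn n) z - xn n < 0"
          using order_tendstoD(2)[OF lim, of 0] by simp
        then have "\<forall>\<^sub>F n in sequentially. indicator {z. clc_stat (an n) (rn n) z \<le> xn n} z
            = (indicator {z. clc_stat a \<rho> z \<le> x} z :: real)"
          by eventually_elim (use True in simp)
        then show ?thesis by (rule tendsto_eventually)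
      next
        case False
        then have "\<forall>\<^sub>F n in sequentially. clc_stat (an n) (rn n) z - xn n > 0"
          using order_tendstoD(1)[OF lim, of 0] elim by simp
        then have "\<forall>\<^sub>F n in sequentially. indicator {z. clc_stat (an n) (rn n) z \<le> xn n} z
            = (indicator {z. clc_stat a \<rho> z \<le> x} z :: real)"
          by eventually_elim (use False elim in simp)
        then show ?thesis by (rule tendsto_eventually)
      qed
    qed
  qed (use m in auto)
  then show "((\<lambda>(a, \<rho>, x). clc_cdf a \<rho> x) \<circ> X) \<longlonglongrightarrow> clc_cdf a \<rho> x"
    by (simp add: cdf_eq comp_def split_beta an_def rn_def xn_def)
qed

lemma phi_inf_eq:
  assumes "0 < \<alpha>" "\<alpha> < 1"
  shows "phi_inf \<alpha> a \<rho> z = (if 1 - \<alpha> \<le> clc_cdf a \<rho> (clc_stat a \<rho> z) then 1 else 0)"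
  by (simp add: phi_inf_def crit_le_iff[OF assms])

text \<open>Exact size requires the distribution function to equal \<open>1 - \<alpha>\<close> at
  the critical value. One inequality is \<open>crit_le_iff\<close>; the other follows by approaching
  from the left, where the values are below \<open>1 - \<alpha>\<close>. Ties with the critical
  value are null.\<close>

lemma integral_phi_inf_null:
  assumes a: "a \<in> A0 abar" and abar: "abar < 1" and rho: "\<bar>\<rho>\<bar> < 1" and level: "0 < \<alpha>" "\<alpha> < 1"
  shows "(\<integral>z. phi_inf \<alpha> a \<rho> z \<partial>normal_pair 0 0) = \<alpha>"
proof -
  interpret prob_space "normal_pair 0 0" by (rule prob_space_normal_pair)
  let ?c = "crit \<alpha> a \<rho>"
  note m = clc_stat_pair_measurable[of a \<rho> 0 0]
  have ge: "1 - \<alpha> \<le> clc_cdf a \<rho> ?c"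
    using crit_le_iff[OF level, of a \<rho> ?c] by simp
  have "isCont (clc_cdf a \<rho>) ?c"
    using finite_borel_measure.isCont_cdf[of "distr (normal_pair 0 0) borel (clc_stat a \<rho>)" ?c]
      clc_distr_real_distribution[of a \<rho>, unfolded real_distribution_def]
      real_distribution.finite_borel_measure_M[OF clc_distr_real_distribution[of a \<rho>]]
      clc_distr_atomless[OF a abar rho] by (simp add: cdf_clc_distr[abs_def])
  then have "(clc_cdf a \<rho> \<longlongrightarrow> clc_cdf a \<rho> ?c) (at_left ?c)"
    by (simp add: continuous_at filterlim_at_split)
  moreover have "\<forall>\<^sub>F y in at_left ?c. clc_cdf a \<rho> y \<le> 1 - \<alpha>"
    unfolding eventually_at_left_field using crit_le_iff[OF level, of a \<rho>]
    by (meson lt_ex less_imp_le not_le)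
  ultimately have "clc_cdf a \<rho> ?c \<le> 1 - \<alpha>"
    by (rule tendsto_upperbound) simp
  with ge have eq: "clc_cdf a \<rho> ?c = 1 - \<alpha>" by simp
  have s: "{z. clc_stat a \<rho> z \<le> ?c} \<in> events"
    using borel_measurable_le[OF m borel_measurable_const[of ?c]] by simp
  have "(\<integral>z. phi_inf \<alpha> a \<rho> z \<partial>normal_pair 0 0) = (\<integral>z. 1 - indicator {z. clc_stat a \<rho> z \<le> ?c} z \<partial>normal_pair 0 0)"
  proof (rule integral_cong_AE)
    show "phi_inf \<alpha> a \<rho> \<in> borel_measurable (normal_pair 0 0)"
      unfolding phi_inf_def[abs_def] using m by measurable
    show "AE z in normal_pair 0 0. phi_inf \<alpha> a \<rho> z = 1 - indicator {z. clc_stat a \<rho> z \<le> ?c} z"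
      using AE_clc_stat_neq[OF a abar rho, of ?c 0 0]
      by eventually_elim (auto simp: phi_inf_def indicator_def)
    show "(\<lambda>z. 1 - indicator {z. clc_stat a \<rho> z \<le> ?c} z :: real) \<in> borel_measurable (normal_pair 0 0)"
      using s by simp
  qed
  also have "\<dots> = 1 - clc_cdf a \<rho> ?c"
    using s prob_space by (simp add: clc_cdf_def emeasure_eq_measure)
  finally show ?thesis using eq by simp
qed

section \<open>Quadratic forms and the projection coefficients\<close>

text \<open>Since \<open>Z^T Z\<close> is symmetric, the transpose of its inverse is a left inverse
  and hence the inverse itself.\<close>

lemma transpose_proj_mat:
  assumes Z: "Z \<in> carrier_mat n k" and inv: "invertible_mat (transpose_mat Z * Z)"
  shows "transpose_mat (proj_mat Z) = proj_mat Z"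
proof -
  let ?A = "transpose_mat Z * Z"
  have A: "?A \<in> carrier_mat k k" using Z by auto
  have symA: "transpose_mat ?A = ?A"
    using Z by (subst transpose_mult[of _ k n _ k]) auto
  obtain C where C: "?A * C = 1\<^sub>m (dim_row ?A)" "C * ?A = 1\<^sub>m (dim_row C)"
    using inv unfolding invertible_mat_def inverts_mat_def by blast
  have "dim_col C = k" using arg_cong[OF C(1), of dim_col] Z by auto
  moreover have "dim_row C = k" using arg_cong[OF C(2), of dim_col] Z by auto
  ultimately have Cc: "C \<in> carrier_mat k k" by auto
  \<comment> \<open>\<open>mat_inverse\<close> returns an option; being a unit of the matrix ring
    excludes \<open>None\<close>.\<close>
  have "?A \<in> Units (ring_mat TYPE(real) k ())"
    unfolding Units_def using A C Cc by (auto simp: ring_mat_simps intro!: bexI[of _ C])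
  then obtain B where B: "mat_inverse ?A = Some B"
    using mat_inverse(1)[OF A, where b = "()"] by (cases "mat_inverse ?A") auto
  from mat_inverse(2)[OF A B] have B': "?A * B = 1\<^sub>m k" "B * ?A = 1\<^sub>m k" "B \<in> carrier_mat k k" by auto
  have "transpose_mat B * ?A = 1\<^sub>m k"
    using arg_cong[OF B'(1), of transpose_mat] transpose_mult[OF A B'(3)] symA by simp
  have "transpose_mat B = transpose_mat B * (?A * B)"
    using B' by simp
  also have "\<dots> = (transpose_mat B * ?A) * B"
    using A B'(3) by (intro assoc_mult_mat[symmetric]) auto
  also have "\<dots> = B" using \<open>transpose_mat B * ?A = 1\<^sub>m k\<close> B'(3) by simp
  finally have symB: "transpose_mat B = B" .
  have "transpose_mat (Z * B * transpose_mat Z) = Z * transpose_mat (Z * B)"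
    using Z B'(3) by (subst transpose_mult[of _ n k _ n]) auto
  also have "\<dots> = Z * (B * transpose_mat Z)"
    using Z B'(3) symB by (subst transpose_mult[of _ n k _ k]) auto
  also have "\<dots> = Z * B * transpose_mat Z"
    using Z B'(3) by (intro assoc_mult_mat[symmetric]) auto
  finally show ?thesis by (simp add: proj_mat_def B)
qed

text \<open>Assumption 1 controls the mixed form only in the order \<open>X, e\<close>; symmetry
  supplies the other order. For \<open>n = 0\<close> nothing is known about \<open>Z\<close>, but
  the sum is empty.\<close>

lemma Qform_commute:
  assumes "n \<ge> 1 \<Longrightarrow> Z \<in> carrier_mat n k \<and> invertible_mat (transpose_mat Z * Z)"
  shows "Qform n K Z a b = Qform n K Z b a"
proof (cases "n = 0")
  case False
  then have Z: "Z \<in> carrier_mat n k" "invertible_mat (transpose_mat Z * Z)" using assms by auto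
  have dim: "dim_row (proj_mat Z) = n" "dim_col (proj_mat Z) = n"
    using Z(1) by (auto simp: proj_mat_def)
  have sym: "proj_mat Z $$ (i, j) = proj_mat Z $$ (j, i)" if "i < n" "j < n" for i j
    using transpose_proj_mat[OF Z] that dim by (metis index_transpose_mat(1))
  have "(\<Sum>i<n. \<Sum>j\<in>{..<n} - {i}. a i * proj_mat Z $$ (i, j) * b j)
      = (\<Sum>j<n. \<Sum>i | i \<in> {..<n} \<and> j \<in> {..<n} - {i}. a i * proj_mat Z $$ (i, j) * b j)"
    by (subst sum.swap_restrict) (auto simp: Diff_eq Int_def intro!: sum.cong)
  also have "\<dots> = (\<Sum>j<n. \<Sum>i\<in>{..<n} - {j}. b j * proj_mat Z $$ (j, i) * a i)"
    by (intro sum.cong) (auto simp: sym)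
  finally show ?thesis by (simp add: Qform_def)
qed (simp add: Qform_def)

lemma Qform_add_left:
  "Qform n K Z (\<lambda>i. a i + c * b i) d = Qform n K Z a d + c * Qform n K Z b d"
  by (simp add: Qform_def algebra_simps sum.distrib sum_distrib_left add_divide_distrib)

lemma Qform_add_right:
  "Qform n K Z d (\<lambda>i. a i + c * b i) = Qform n K Z d a + c * Qform n K Z d b"
  by (simp add: Qform_def algebra_simps sum.distrib sum_distrib_left add_divide_distrib)

lemma Qform_cong:
  assumes "\<And>i. i < n \<Longrightarrow> a i = a' i" "\<And>i. i < n \<Longrightarrow> b i = b' i"
  shows "Qform n K Z a b = Qform n K Z a' b'"
  unfolding Qform_def using assms by (intro arg_cong2[where f = "(/)"] sum.cong refl) auto

lemma Qform_measurable:
  assumes "\<And>i. i < n \<Longrightarrow> (\<lambda>\<omega>. f i \<omega>) \<in> borel_measurable M" "\<And>i. i < n \<Longrightarrow> (\<lambda>\<omega>. g i \<omega>) \<in> borel_measurable M"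
  shows "(\<lambda>\<omega>. Qform n K Z (\<lambda>i. f i \<omega>) (\<lambda>i. g i \<omega>)) \<in> borel_measurable M"
  unfolding Qform_def using assms by (intro borel_measurable_divide borel_measurable_sum borel_measurable_times) auto

lemma matrix_inv_unique:
  fixes A B :: "real^'n^'n"
  assumes AB: "A ** B = Finite_Cartesian_Product.mat 1" and BA: "B ** A = Finite_Cartesian_Product.mat 1"
  shows "matrix_inv A = B"
proof -
  have "A ** matrix_inv A = Finite_Cartesian_Product.mat 1 \<and> matrix_inv A ** A = Finite_Cartesian_Product.mat 1"
    unfolding matrix_inv_def by (rule someI[of _ B]) (simp add: assms)
  then have "matrix_inv A ** (A ** B) = B" by (simp add: matrix_mul_assoc)
  then show ?thesis by (simp add: AB)
qed

lemma matrix_inv_2: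
  fixes p q r s :: real
  assumes d: "p * s - q * r \<noteq> 0"
  shows "matrix_inv (vector [vector [p, q], vector [r, s]] :: real^2^2)
    = vector [vector [s / (p * s - q * r), - q / (p * s - q * r)], vector [- r / (p * s - q * r), p / (p * s - q * r)]]"
    (is "matrix_inv ?A = ?B")
proof -
  have "?A ** ?B = Finite_Cartesian_Product.mat 1" "?B ** ?A = Finite_Cartesian_Product.mat 1"
    using d by (simp_all add: Finite_Cartesian_Product.vec_eq_iff forall_2 matrix_matrix_mult_def Finite_Cartesian_Product.mat_def sum_2 divide_simps)
  then show ?thesis by (rule matrix_inv_unique)
qed

text \<open>For singular \<open>A\<close> the choice defining \<open>matrix_inv A\<close> is over an empty set; it is the same unspecified matrix
  for all such \<open>A\<close>, so that \<open>proj_coef\<close> is measurable everywhere.\<close>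
lemma matrix_inv_singular:
  fixes A :: "real^2^2"
  assumes "Determinants.det A = 0"
  shows "matrix_inv A = matrix_inv 0"
proof -
  have 1: "\<not> (A ** B = Finite_Cartesian_Product.mat 1 \<and> B ** A = Finite_Cartesian_Product.mat 1)" for B
    using assms invertible_det_nz[of A] by (auto simp: invertible_def)
  have 2: "\<not> ((0::real^2^2) ** B = Finite_Cartesian_Product.mat 1 \<and> B ** 0 = Finite_Cartesian_Product.mat 1)" for B
    using invertible_det_nz[of "0::real^2^2"] by (auto simp: invertible_def det_2)
  show ?thesis
    unfolding matrix_inv_def by (rule arg_cong[where f = Eps], rule ext) (use 1 2 in blast)
qed

lemma proj_coef_nonsingular:
  assumes "\<Phi>1 * \<Psi> - \<Phi>12 * \<Phi>12 \<noteq> 0"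
  shows "proj_coef (\<Phi>1, \<Phi>12, \<Phi>13, \<Psi>, \<tau>, \<Upsilon>, \<rho>)
     = vector [(\<Psi> * \<Phi>13 - \<Phi>12 * \<tau>) / (\<Phi>1 * \<Psi> - \<Phi>12 * \<Phi>12), (\<Phi>1 * \<tau> - \<Phi>12 * \<Phi>13) / (\<Phi>1 * \<Psi> - \<Phi>12 * \<Phi>12)]"
  using matrix_inv_2[OF assms]
  by (simp add: Finite_Cartesian_Product.vec_eq_iff forall_2 matrix_vector_mult_def sum_2 diff_divide_distrib)

lemma rho_of_measurable: "rho_of \<in> borel_measurable borel"
proof -
  have eq: "rho_of = (\<lambda>r. snd (snd (snd (snd (snd (snd r))))))" by (auto simp: fun_eq_iff)
  show ?thesis unfolding eq by (intro borel_measurable_continuous_onI continuous_intros)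
qed

text \<open>The determinant of the matrix with rows \<open>(\<Phi>1, \<Phi>12)\<close> and
  \<open>(\<Phi>12, \<Psi>)\<close>. Projections instead of pattern matching make it visibly
  continuous in \<open>r\<close>.\<close>

definition gram_det :: "gam \<Rightarrow> real" where
  "gram_det r = fst r * fst (snd (snd (snd r))) - fst (snd r) * fst (snd r)"

text \<open>The numerators in Cramer's rule for the two components of
  \<open>proj_coef\<close>.\<close>

definition proj_coef_num :: "gam \<Rightarrow> 2 \<Rightarrow> real" where
  "proj_coef_num r i = (if i = 1 then fst (snd (snd (snd r))) * fst (snd (snd r)) - fst (snd r) * fst (snd (snd (snd (snd r))))
     else fst r * fst (snd (snd (snd (snd r)))) - fst (snd r) * fst (snd (snd r)))"

lemma proj_coef_eq:
  "proj_coef r $ i = (if gram_det r \<noteq> 0 then proj_coef_num r i / gram_det r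
     else (matrix_inv (0 :: real^2^2) *v vector [fst (snd (snd r)), fst (snd (snd (snd (snd r))))] :: real^2) $ i)"
proof -
  obtain \<Phi>1 \<Phi>12 \<Phi>13 \<Psi> \<tau> \<Upsilon> \<rho> where r: "r = (\<Phi>1, \<Phi>12, \<Phi>13, \<Psi>, \<tau>, \<Upsilon>, \<rho>)" by (metis surj_pair)
  show ?thesis
  proof (cases "gram_det r = 0")
    case True
    then have "Determinants.det (vector [vector [\<Phi>1, \<Phi>12], vector [\<Phi>12, \<Psi>]] :: real^2^2) = 0"
      by (simp add: r gram_det_def det_2)
    from matrix_inv_singular[OF this] True show ?thesis by (simp add: r)
  next
    case False
    then have "\<Phi>1 * \<Psi> - \<Phi>12 * \<Phi>12 \<noteq> 0" by (simp add: r gram_det_def)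
    from proj_coef_nonsingular[OF this] False show ?thesis
      using exhaust_2[of i] by (auto simp: r gram_det_def proj_coef_num_def)
  qed
qed

lemma continuous_gram_det: "continuous_on UNIV gram_det"
  unfolding gram_det_def by (intro continuous_intros)

lemma continuous_proj_coef_num: "continuous_on UNIV (\<lambda>r. proj_coef_num r i)"
  unfolding proj_coef_num_def by (cases "i = 1") (auto intro!: continuous_intros)

lemma proj_coef_measurable: "(\<lambda>r. proj_coef r $ i) \<in> borel_measurable borel"
proof -
  have [measurable]: "gram_det \<in> borel_measurable borel" "(\<lambda>r. proj_coef_num r i) \<in> borel_measurable borel"
    by (rule borel_measurable_continuous_onI[OF continuous_gram_det] borel_measurable_continuous_onI[OF continuous_proj_coef_num])+
  have [measurable]: "(\<lambda>r::gam. (matrix_inv (0 :: real^2^2) *v vector [fst (snd (snd r)), fst (snd (snd (snd (snd r))))] :: real^2) $ i) \<in> borel_measurable borel"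
    by (auto simp: matrix_vector_mult_def sum_2 intro!: borel_measurable_continuous_onI continuous_intros)
  show ?thesis unfolding proj_coef_eq by measurable
qed

text \<open>The determinant stays nonzero near \<open>r\<close>, so Cramer's formula holds on a
  whole neighbourhood.\<close>

lemma isCont_proj_coef:
  assumes "gram_det r \<noteq> 0"
  shows "isCont (\<lambda>r. proj_coef r $ i) r"
proof -
  have c: "isCont gram_det r" "isCont (\<lambda>r. proj_coef_num r i) r"
    using continuous_gram_det continuous_proj_coef_num[of i]
    unfolding continuous_on_eq_continuous_at[OF open_UNIV] by blast+
  have "\<forall>\<^sub>F r' in nhds r. gram_det r' \<noteq> 0"
    using c(1) assms by (simp add: isCont_def tendsto_imp_eventually_ne eventually_nhds_conv_at)
  then have "\<forall>\<^sub>F r' in nhds r. proj_coef r' $ i = proj_coef_num r' i / gram_det r'"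
    by eventually_elim (simp add: proj_coef_eq)
  moreover have "isCont (\<lambda>r. proj_coef_num r i / gram_det r) r"
    using c assms by (intro continuous_intros)
  ultimately show ?thesis by (subst isCont_cong)
qed

section \<open>The limit law of the statistics\<close>

lemma cov_matrix_mult:
  "cov_matrix (\<Phi>1, \<Phi>12, \<Phi>13, \<Psi>, \<tau>, \<Upsilon>) *v vector [x, y, z] =
     (vector [\<Phi>1 * x + \<Phi>12 * y + \<Phi>13 * z, \<Phi>12 * x + \<Psi> * y + \<tau> * z, \<Phi>13 * x + \<tau> * y + \<Upsilon> * z] :: real^3)"
  by (simp add: Finite_Cartesian_Product.vec_eq_iff forall_3 matrix_vector_mult_def sum_3)

text \<open>Coefficients of \<open>Q\<^bsub>e(\<beta>\<^sub>0),e(\<beta>\<^sub>0)\<^esub>\<close>, \<open>Q\<^bsub>X,e(\<beta>\<^sub>0)\<^esub>\<close> and \<open>Q\<^bsub>X,X\<^esub>\<close> as linear functionals of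
  \<open>(Q\<^bsub>e,e\<^esub>, Q\<^bsub>X,e\<^esub>, Q\<^bsub>X,X\<^esub>)\<close>.\<close>
definition dir_ee :: "real \<Rightarrow> real^3" where "dir_ee \<Delta> = vector [1, 2 * \<Delta>, \<Delta>^2]"
definition dir_Xe :: "real \<Rightarrow> real^3" where "dir_Xe \<Delta> = vector [0, 1, \<Delta>]"
definition dir_XX :: "real^3" where "dir_XX = vector [0, 0, 1]"

text \<open>With \<open>S = L L^T\<close> the covariance \<open>u^T S v\<close> is the inner product
  of \<open>u v* L\<close> and \<open>v v* L\<close>. The variance functions at the hypothesized
  value are this form evaluated at the three directions.\<close>

lemma cov_directions:
  assumes L: "cov_matrix \<theta> = L ** Finite_Cartesian_Product.transpose L"
  shows "inner (dir_ee \<Delta> v* L) (dir_ee \<Delta> v* L) = Phi1_at \<theta> \<Delta>"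
    "inner (dir_ee \<Delta> v* L) (dir_Xe \<Delta> v* L) = Phi12_at \<theta> \<Delta>"
    "inner (dir_ee \<Delta> v* L) (dir_XX v* L) = Phi13_at \<theta> \<Delta>"
    "inner (dir_Xe \<Delta> v* L) (dir_Xe \<Delta> v* L) = Psi_at \<theta> \<Delta>"
    "inner (dir_Xe \<Delta> v* L) (dir_XX v* L) = tau_at \<theta> \<Delta>"
    "inner (dir_XX v* L) (dir_XX v* L) = Upsilon_of \<theta>"
proof -
  obtain \<Phi>1 \<Phi>12 \<Phi>13 \<Psi> \<tau> \<Upsilon> where \<theta>: "\<theta> = (\<Phi>1, \<Phi>12, \<Phi>13, \<Psi>, \<tau>, \<Upsilon>)" by (metis surj_pair)
  have eq: "inner (u v* L) (v v* L) = inner u (cov_matrix \<theta> *v v)" for u v :: "real^3"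
    unfolding L by (simp add: dot_lmul_matrix flip: matrix_vector_mul_assoc)
  note defs = dir_ee_def dir_Xe_def dir_XX_def \<theta> cov_matrix_mult inner_vec_def sum_3
  show "inner (dir_ee \<Delta> v* L) (dir_ee \<Delta> v* L) = Phi1_at \<theta> \<Delta>"
    "inner (dir_ee \<Delta> v* L) (dir_Xe \<Delta> v* L) = Phi12_at \<theta> \<Delta>"
    "inner (dir_ee \<Delta> v* L) (dir_XX v* L) = Phi13_at \<theta> \<Delta>"
    "inner (dir_Xe \<Delta> v* L) (dir_Xe \<Delta> v* L) = Psi_at \<theta> \<Delta>"
    "inner (dir_Xe \<Delta> v* L) (dir_XX v* L) = tau_at \<theta> \<Delta>"
    "inner (dir_XX v* L) (dir_XX v* L) = Upsilon_of \<theta>"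
    unfolding eq unfolding defs by (simp_all; simp add: power2_eq_square power3_eq_cube power4_eq_xxxx algebra_simps)+
qed

text \<open>A correlation strictly inside \<open>(-1, 1)\<close> is strict Cauchy-Schwarz, hence
  nonsingularity.\<close>

lemma gram_det_gamma_at:
  assumes pos: "0 < Phi1_at \<theta> \<Delta>" "0 < Psi_at \<theta> \<Delta>" and rho: "\<bar>rho_at \<theta> \<Delta>\<bar> < 1"
  shows "0 < gram_det (gamma_at \<theta> \<Delta>)"
proof -
  have "(rho_at \<theta> \<Delta>)^2 < 1" using rho by (simp add: abs_square_less_1)
  then have "Phi12_at \<theta> \<Delta> ^ 2 < Phi1_at \<theta> \<Delta> * Psi_at \<theta> \<Delta>"
    using pos by (simp add: rho_at_def power_divide divide_less_eq)
  then show ?thesis by (simp add: gram_det_def gamma_at_def power2_eq_square)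
qed

text \<open>The statistics are a Gram-Schmidt process: \<open>AR\<close> normalises the first
  functional, \<open>LM*\<close> the residual of the second on the first, and \<open>D\<close> is
  the unnormalised residual of the third on both. The constant \<open>c\<close> restores the
  centring of \<open>Q_XX\<close> and enters the three forms with factors \<open>\<Delta>^2\<close>,
  \<Delta> and 1.\<close>

lemma distr_limit_statistics:
  fixes L :: "real^3^3" and \<Delta> c :: real
  assumes L: "cov_matrix \<theta> = L ** Finite_Cartesian_Product.transpose L"
    and pos: "0 < Phi1_at \<theta> \<Delta>" "0 < Psi_at \<theta> \<Delta>" and rho: "\<bar>rho_at \<theta> \<Delta>\<bar> < 1"
    and r: "r = gamma_at \<theta> \<Delta>"
  defines "qee \<equiv> \<lambda>w. inner (dir_ee \<Delta>) w + \<Delta>^2 * c" and "qXe \<equiv> \<lambda>w. inner (dir_Xe \<Delta>) w + \<Delta> * c"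
    and "qXX \<equiv> \<lambda>w. inner dir_XX w + c"
  shows "distr std_normal_vec (borel \<Otimes>\<^sub>M (borel \<Otimes>\<^sub>M borel))
      (\<lambda>z. (D_stat r (qee (L *v z)) (qXe (L *v z)) (qXX (L *v z)),
            AR_stat r (qee (L *v z)), LMstar_stat r (qee (L *v z)) (qXe (L *v z))))
    = normal_law (c * G_fun \<Delta> r) ((sigma_D r)^2) \<Otimes>\<^sub>M normal_pair (C1_num \<Delta> r * c) (C2_num \<Delta> r * c)"
proof -
  define f1 where "f1 = Phi1_at \<theta> \<Delta>"
  define f12 where "f12 = Phi12_at \<theta> \<Delta>"
  define f13 where "f13 = Phi13_at \<theta> \<Delta>"
  define ps where "ps = Psi_at \<theta> \<Delta>"
  define ta where "ta = tau_at \<theta> \<Delta>"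
  define up where "up = Upsilon_of \<theta>"
  define \<rho> where "\<rho> = rho_at \<theta> \<Delta>"
  define p1 where "p1 = (ps * f13 - f12 * ta) / (f1 * ps - f12 * f12)"
  define p2 where "p2 = (f1 * ta - f12 * f13) / (f1 * ps - f12 * f12)"
  define k1 where "k1 = dir_ee \<Delta> v* L"
  define k2 where "k2 = dir_Xe \<Delta> v* L"
  define k3 where "k3 = dir_XX v* L"
  have r': "r = (f1, f12, f13, ps, ta, up, \<rho>)"
    by (simp add: r gamma_at_def f1_def f12_def f13_def ps_def ta_def up_def \<rho>_def)
  have f1: "0 < f1" and ps: "0 < ps" using pos by (simp_all add: f1_def ps_def)
  have d: "0 < f1 * ps - f12 * f12"
    using gram_det_gamma_at[OF pos rho] by (simp add: r[symmetric] r' gram_det_def)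
  have pc: "proj_coef r = vector [p1, p2]"
    unfolding r' p1_def p2_def by (rule proj_coef_nonsingular) (use d in simp)
  have k: "inner k1 k1 = f1" "inner k1 k2 = f12" "inner k1 k3 = f13" "inner k2 k2 = ps" "inner k2 k3 = ta" "inner k3 k3 = up"
    using cov_directions(1-5)[OF L, of \<Delta>] cov_directions(6)[OF L]
    by (simp_all add: k1_def k2_def k3_def f1_def f12_def f13_def ps_def ta_def up_def)
  have k': "inner k2 k1 = f12" "inner k3 k1 = f13" "inner k3 k2 = ta"
    using k by (simp_all only: inner_commute[of k2 k1] inner_commute[of k3 k1] inner_commute[of k3 k2])
  \<comment> \<open>The normal equations: \<open>p1\<close> and \<open>p2\<close> are the regression
    coefficients of \<open>k3\<close> on \<open>k1\<close> and \<open>k2\<close>.\<close>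
  have n1: "f13 - p1 * f1 - p2 * f12 = 0" "ta - p1 * f12 - p2 * ps = 0"
    using d unfolding p1_def p2_def by (simp_all add: field_simps)
  define t1 where "t1 = (1 / sqrt f1) *\<^sub>R k1"
  define t2 where "t2 = (1 / sqrt (1 - \<rho>^2)) *\<^sub>R ((1 / sqrt ps) *\<^sub>R k2 - (\<rho> / sqrt f1) *\<^sub>R k1)"
  define t3 where "t3 = k3 - p1 *\<^sub>R k1 - p2 *\<^sub>R k2"
  have rho1: "0 < 1 - \<rho>^2" using rho by (simp add: \<rho>_def abs_square_less_1)
  have rho_eq: "f12 = \<rho> * (sqrt f1 * sqrt ps)"
    using f1 ps by (simp add: \<rho>_def rho_at_def f12_def f1_def ps_def real_sqrt_mult)
  have sq: "sqrt f1 * sqrt f1 = f1" "sqrt ps * sqrt ps = ps" "sqrt (1 - \<rho>^2) * sqrt (1 - \<rho>^2) = 1 - \<rho>^2"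
    using f1 ps rho1 by simp_all
  have nz: "sqrt f1 \<noteq> 0" "sqrt ps \<noteq> 0" "sqrt (1 - \<rho>^2) \<noteq> 0" using f1 ps rho1 by simp_all
  have e: "inner k1 k1 = sqrt f1 * sqrt f1" "inner k2 k2 = sqrt ps * sqrt ps"
    "inner k1 k2 = \<rho> * (sqrt f1 * sqrt ps)" "inner k2 k1 = \<rho> * (sqrt f1 * sqrt ps)"
    using k k' sq rho_eq by simp_all
  have t11: "inner t1 t1 = 1" using nz by (simp add: t1_def e)
  have t12: "inner t1 t2 = 0"
    using nz by (simp add: t1_def t2_def inner_diff_right e)
  \<comment> \<open>Stated for arbitrary nonzero \<open>x\<close> and \<open>y\<close>, so that the
    square roots act as atoms in the field arithmetic.\<close>
  have "inner ((1 / y) *\<^sub>R k2 - (\<rho> / x) *\<^sub>R k1) ((1 / y) *\<^sub>R k2 - (\<rho> / x) *\<^sub>R k1) = 1 - \<rho>^2"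
    if "x \<noteq> 0" "y \<noteq> 0" "inner k1 k1 = x * x" "inner k2 k2 = y * y" "inner k1 k2 = \<rho> * (x * y)" "inner k2 k1 = \<rho> * (x * y)" for x y
    using that by (simp add: inner_diff_right inner_diff_left power2_eq_square field_simps)
  from this[OF nz(1,2) e]
  have "inner ((1 / sqrt ps) *\<^sub>R k2 - (\<rho> / sqrt f1) *\<^sub>R k1) ((1 / sqrt ps) *\<^sub>R k2 - (\<rho> / sqrt f1) *\<^sub>R k1) = 1 - \<rho>^2" .
  then have t22: "inner t2 t2 = 1"
    using nz sq(3) by (simp add: t2_def)
  have t3k1: "inner t3 k1 = 0" and t3k2: "inner t3 k2 = 0"
    using n1 k k' by (simp_all add: t3_def inner_diff_left)
  then have t31: "inner t3 t1 = 0" and t32: "inner t3 t2 = 0"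
    by (simp_all add: t1_def t2_def inner_diff_right)
  \<comment> \<open>The residual is orthogonal to \<open>k1\<close> and \<open>k2\<close>, so only
    its product with \<open>k3\<close> survives. Being a squared norm, this also shows that the
    radicand of \<open>sigma_D\<close> is nonnegative.\<close>
  have "inner t3 t3 = inner t3 k3"
    unfolding t3_def[THEN arg_cong[where f = "inner t3"]] using t3k1 t3k2 by (simp add: inner_diff_right)
  also have "\<dots> = up - inner (vector [f13, ta]) (proj_coef r)"
    unfolding t3_def inner_diff_left inner_scaleR_left k
    by (simp add: pc inner_vec_def[where 'b=2] sum_2)
  finally have t33: "inner t3 t3 = (sigma_D r)^2"
    using inner_ge_zero[of t3] by (simp add: r')
  have sig0: "0 \<le> sigma_D r"
    using inner_ge_zero[of t3] \<open>inner t3 t3 = inner t3 k3\<close> \<open>inner t3 k3 = _\<close> by (simp add: r')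
  have q: "qee (L *v z) = inner k1 z + \<Delta>^2 * c" "qXe (L *v z) = inner k2 z + \<Delta> * c" "qXX (L *v z) = inner k3 z + c" for z
    by (simp_all add: qee_def qXe_def qXX_def k1_def k2_def k3_def dot_lmul_matrix)
  have "D_stat r (qee (L *v z)) (qXe (L *v z)) (qXX (L *v z)) = c * G_fun \<Delta> r + inner t3 z" for z
    by (simp add: q D_stat_def G_fun_def pc inner_vec_def[where 'b=2] sum_2 t3_def inner_diff_left) (simp add: algebra_simps)
  moreover have "AR_stat r (qee (L *v z)) = C1_num \<Delta> r * c + inner t1 z" for z
    by (simp add: q r' t1_def add_divide_distrib)
  moreover have "LMstar_stat r (qee (L *v z)) (qXe (L *v z)) = C2_num \<Delta> r * c + inner t2 z" for z
    by (simp add: q r' t2_def LMstar_stat_def inner_diff_left add_divide_distrib diff_divide_distrib algebra_simps)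
  ultimately show ?thesis
    using distr_std_normal_vec_linear[OF t11 t22 t12 t31 t32 t33 sig0] by simp
qed

text \<open>If \<open>\<sigma>\<^sub>D = 0\<close>, then \<open>D\<close> is constant and could a priori sit in the Lebesgue null set of
  discontinuities; but then \<open>f\<^sub>s\<close> vanishes identically and there are none.\<close>
lemma discont_degenerate:
  assumes "sigma_D r = 0"
  shows "discont a s r = {}"
proof -
  have "f_rule s d r = 0" for d using assms by (cases s) (simp_all add: Let_def)
  then show ?thesis by (simp add: discont_def weights_def)
qed

lemma LM_stat_eq:
  assumes "\<bar>rho_of r\<bar> < 1"
  shows "LM_stat r qXe = rho_of r * AR_stat r qee + sqrt (1 - (rho_of r)^2) * LMstar_stat r qee qXe"
proof -
  have "sqrt (1 - (rho_of r)^2) \<noteq> 0" using assms abs_square_less_1[of "rho_of r"] by simp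
  then show ?thesis by (simp add: LMstar_stat_def)
qed

lemma clc_test_eq:
  assumes "0 < \<alpha>" "\<alpha> < 1"
  shows "clc_test \<alpha> A g qee qXe = (if 1 - \<alpha> \<le> clc_cdf A (rho_of g)
      (fst A * (AR_stat g qee)^2 + snd A * (LM_stat g qXe)^2 + (1 - fst A - snd A) * (LMstar_stat g qee qXe)^2)
      then 1 else 0)"
  by (simp add: clc_test_def crit_le_iff[OF assms])

text \<open>On the sample space the residual is \<open>e + \<Delta> X\<close>; the coefficient
  \<open>2 * \<Delta>\<close> arises when the two mixed forms are merged by symmetry.\<close>

lemma Qform_residual:
  assumes model: "iv_model M K Z \<beta> mX V e X Y" and \<omega>: "\<omega> \<in> space (M n)" and \<Delta>: "\<Delta> = \<beta> - \<beta>0"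
  defines "w1 \<equiv> Qform n (K n) (Z n) (\<lambda>i. e n i \<omega>) (\<lambda>i. e n i \<omega>)"
    and "w2 \<equiv> Qform n (K n) (Z n) (\<lambda>i. X n i \<omega>) (\<lambda>i. e n i \<omega>)"
  shows "Q_ee0 K Z X Y \<beta>0 n \<omega> = w1 + 2 * \<Delta> * w2 + \<Delta>^2 * Q_XX K Z X n \<omega>"
    and "Q_Xe0 K Z X Y \<beta>0 n \<omega> = w2 + \<Delta> * Q_XX K Z X n \<omega>"
proof -
  have res: "resid X Y \<beta>0 n i \<omega> = e n i \<omega> + \<Delta> * X n i \<omega>" if "i < n" for i
    using model \<omega> that by (auto simp: iv_model_def resid_def \<Delta> algebra_simps)
  have com: "Qform n (K n) (Z n) a b = Qform n (K n) (Z n) b a" for a b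
    using model by (intro Qform_commute[where k = "K n"]) (auto simp: iv_model_def)
  have "Q_ee0 K Z X Y \<beta>0 n \<omega> = Qform n (K n) (Z n) (\<lambda>i. e n i \<omega> + \<Delta> * X n i \<omega>) (\<lambda>i. e n i \<omega> + \<Delta> * X n i \<omega>)"
    unfolding Q_ee0_def by (rule Qform_cong) (simp_all add: res)
  then show "Q_ee0 K Z X Y \<beta>0 n \<omega> = w1 + 2 * \<Delta> * w2 + \<Delta>^2 * Q_XX K Z X n \<omega>"
    unfolding Qform_add_left Qform_add_right w1_def w2_def Q_XX_def
    using com[of "\<lambda>i. e n i \<omega>" "\<lambda>i. X n i \<omega>"] by (simp add: power2_eq_square algebra_simps)
  have "Q_Xe0 K Z X Y \<beta>0 n \<omega> = Qform n (K n) (Z n) (\<lambda>i. X n i \<omega>) (\<lambda>i. e n i \<omega> + \<Delta> * X n i \<omega>)"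
    unfolding Q_Xe0_def by (rule Qform_cong) (simp_all add: res)
  then show "Q_Xe0 K Z X Y \<beta>0 n \<omega> = w2 + \<Delta> * Q_XX K Z X n \<omega>"
    unfolding Qform_add_right w2_def Q_XX_def .
qed

lemma iv_model_measurable:
  assumes model: "iv_model M K Z \<beta> mX V e X Y" and i: "i < n"
  shows "e n i \<in> borel_measurable (M n)" "X n i \<in> borel_measurable (M n)"
proof -
  have 1: "integrable (M n) (e n i)" "integrable (M n) (V n i)"
    "\<And>\<omega>. \<omega> \<in> space (M n) \<Longrightarrow> X n i \<omega> = mX n i + V n i \<omega>"
    using model i by (auto simp: iv_model_def)
  then show "e n i \<in> borel_measurable (M n)" by auto
  have "(\<lambda>\<omega>. mX n i + V n i \<omega>) \<in> borel_measurable (M n)" using 1(2) by auto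
  then show "X n i \<in> borel_measurable (M n)"
    using 1(3) by (subst measurable_cong[of "M n" _ "\<lambda>\<omega>. mX n i + V n i \<omega>"]) auto
qed

text \<open>This and the next three equations replace patterns by projections, from which
  measurability and continuity can be read off.\<close>

lemma AR_stat_alt: "AR_stat r q = q / sqrt (fst r)"
  by (metis AR_stat.simps prod.collapse)

lemma LM_stat_alt: "LM_stat r q = q / sqrt (fst (snd (snd (snd r))))"
  by (metis LM_stat.simps prod.collapse)

lemma rho_of_alt: "rho_of r = snd (snd (snd (snd (snd (snd r)))))"
  by (metis rho_of.simps prod.collapse)

lemma D_stat_alt: "D_stat g qee qXe qXX = qXX - (qee * proj_coef g $ 1 + qXe * proj_coef g $ 2)"
  by (simp add: D_stat_def inner_vec_def sum_2)

section \<open>Convergence of the feasible test\<close>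

text \<open>Lets the deterministic, drifting \<open>conc\<close> be treated as one more consistently
  estimated parameter.\<close>

lemma conv_in_prob_Pair_const:
  fixes x :: "'b::euclidean_space"
  assumes M: "\<And>n. prob_space (M n)" and X: "conv_in_prob M X x" "\<And>n. X n \<in> borel_measurable (M n)"
    and y: "y \<longlonglongrightarrow> (c::real)"
  shows "conv_in_prob M (\<lambda>n \<omega>. (X n \<omega>, y n)) (x, c)"
  unfolding conv_in_prob_def
proof (intro allI impI)
  fix \<epsilon> :: real assume eps: "0 < \<epsilon>"
  have "(\<lambda>n. measure (M n) {\<omega> \<in> space (M n). \<epsilon> / 2 \<le> norm (X n \<omega> - x)}) \<longlonglongrightarrow> 0"
    using X(1) half_gt_zero[OF eps] unfolding conv_in_prob_def by blast
  moreover have "\<forall>\<^sub>F n in sequentially. norm (measure (M n) {\<omega> \<in> space (M n). \<epsilon> \<le> norm ((X n \<omega>, y n) - (x, c))})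
      \<le> measure (M n) {\<omega> \<in> space (M n). \<epsilon> / 2 \<le> norm (X n \<omega> - x)}"
    using tendstoD[OF y half_gt_zero[OF eps]]
  proof eventually_elim
    case (elim n)
    interpret prob_space "M n" by (rule M)
    note [measurable] = X(2)
    have "\<epsilon> / 2 \<le> norm (X n \<omega> - x)" if "\<epsilon> \<le> norm ((X n \<omega>, y n) - (x, c))" for \<omega>
    proof -
      have "norm ((X n \<omega>, y n) - (x, c)) \<le> norm (X n \<omega> - x) + norm (y n - c)"
        using sqrt_sum_squares_le_sum[of "norm (X n \<omega> - x)" "norm (y n - c)"] by (simp add: norm_Pair)
      then show ?thesis using that elim by (simp add: dist_real_def)
    qed
    then show ?case by (auto intro!: finite_measure_mono)
  qed
  ultimately show "(\<lambda>n. measure (M n) {\<omega> \<in> space (M n). \<epsilon> \<le> norm ((X n \<omega>, y n) - (x, c))}) \<longlonglongrightarrow> 0"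
    by (rule Lim_null_comparison[rotated])
qed

lemma vector_3_eq: "vector [x, y, z] = (\<chi> i::3. if i = 1 then x else if i = 2 then y else z)"
  by (simp add: Finite_Cartesian_Product.vec_eq_iff forall_3)

lemma AE_normal_law:
  assumes "N \<in> null_sets lborel" "v \<noteq> 0"
  shows "AE d in normal_law m v. d \<notin> N"
proof -
  have eq: "normal_law m v = density lborel (\<lambda>x. ennreal (normal_density m (sqrt v) x))"
    using assms(2) by (simp add: normal_law_def)
  show ?thesis
    unfolding eq using AE_not_in[OF assms(1)] by (subst AE_density) auto
qed

text \<open>A real infimum bounds the values only if they are bounded below, which compactness and
  continuity guarantee.\<close>

lemma pos_of_INF_pos:
  fixes f :: "real \<Rightarrow> real"
  assumes "compact B" "\<beta>0 \<in> B" "continuous_on UNIV f" "0 < (INF b\<in>B. f (\<beta> - b))"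
  shows "0 < f (\<beta> - \<beta>0)"
proof -
  have "continuous_on B (\<lambda>b. f (\<beta> - b))"
    using continuous_on_compose2[OF assms(3) continuous_on_op_minus[of B \<beta>]] by simp
  then have "bounded ((\<lambda>b. f (\<beta> - b)) ` B)"
    using assms(1) by (intro compact_imp_bounded compact_continuous_image)
  then have "(INF b\<in>B. f (\<beta> - b)) \<le> f (\<beta> - \<beta>0)"
    using assms(2) by (intro cINF_lower bounded_imp_bdd_below)
  with assms(4) show ?thesis by simp
qed

lemma continuous_Phi1_at: "continuous_on UNIV (Phi1_at \<theta>)"
proof -
  obtain \<Phi>1 \<Phi>12 \<Phi>13 \<Psi> \<tau> \<Upsilon> where "\<theta> = (\<Phi>1, \<Phi>12, \<Phi>13, \<Psi>, \<tau>, \<Upsilon>)" by (metis surj_pair)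
  then show ?thesis by (auto intro!: continuous_intros simp: fun_eq_iff[symmetric])
qed

lemma continuous_Psi_at: "continuous_on UNIV (Psi_at \<theta>)"
proof -
  obtain \<Phi>1 \<Phi>12 \<Phi>13 \<Psi> \<tau> \<Upsilon> where "\<theta> = (\<Phi>1, \<Phi>12, \<Phi>13, \<Psi>, \<tau>, \<Upsilon>)" by (metis surj_pair)
  then show ?thesis by (auto intro!: continuous_intros simp: fun_eq_iff[symmetric])
qed

lemma measurable_clc_cdf_selection:
  assumes w: "w \<in> borel_measurable (borel :: real measure)"
  shows "(\<lambda>q. clc_cdf (w (fst q)) \<rho> (clc_stat (w (fst q)) \<rho> (fst (snd q), snd (snd q))))
    \<in> borel_measurable (borel \<Otimes>\<^sub>M (borel \<Otimes>\<^sub>M borel))"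
proof -
  have [measurable]: "(\<lambda>q. w (fst q)) \<in> borel_measurable (borel \<Otimes>\<^sub>M (borel \<Otimes>\<^sub>M borel))"
    by (rule measurable_compose[OF measurable_fst w])
  show ?thesis by (intro measurable_clc_cdf measurable_clc_stat) measurable
qed

lemma measurable_phi_inf_selection:
  assumes level: "0 < \<alpha>" "\<alpha> < 1" and w: "w \<in> borel_measurable (borel :: real measure)"
  shows "(\<lambda>q. phi_inf \<alpha> (w (fst q)) \<rho> (snd q)) \<in> borel_measurable (borel \<Otimes>\<^sub>M (borel \<Otimes>\<^sub>M borel))"
  unfolding phi_inf_eq[OF level] using measurable_clc_cdf_selection[OF w, of \<rho>] by simp measurable

text \<open>One test function \<open>H\<close> of weights, decision and \<open>D\<close> serves all
  the claims. Its bound is required only at decisions 0 and 1, because the choice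
  \<open>(t - \<alpha>) * h d\<close> is in general unbounded in \<open>t\<close>.\<close>

lemma conv_feasible_test:
  fixes M :: "nat \<Rightarrow> 'a measure"
    and mX :: "nat \<Rightarrow> nat \<Rightarrow> real" and V e X Y :: "nat \<Rightarrow> nat \<Rightarrow> 'a \<Rightarrow> real"
    and H :: "(real \<times> real) \<times> real \<times> real \<Rightarrow> real"
  assumes model: "iv_model M K Z \<beta> mX V e X Y"
    and level: "0 < \<alpha>" "\<alpha> < 1"
    and abar: "abar < 1"
    and Delta_def: "\<Delta> = \<beta> - \<beta>0"
    and gamma0_def: "\<gamma>0 = gamma_at \<theta> \<Delta>"
    and rho: "\<bar>rho_at \<theta> \<Delta>\<bar> < 1"
    and pos: "0 < Phi1_at \<theta> \<Delta>" "0 < Psi_at \<theta> \<Delta>"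
    and Gamma: "\<gamma>0 \<in> \<Gamma>" "\<And>n \<omega>. \<omega> \<in> space (M n) \<Longrightarrow> gh n \<beta>0 \<omega> \<in> \<Gamma>"
    and weights_A0: "\<And>d. weights a s d \<gamma>0 \<in> A0 abar"
    and A_meas: "\<And>n. A_hat K Z X Y \<beta>0 gh a s n \<in> borel_measurable (M n)"
    and weights_meas: "(\<lambda>d. weights a s d \<gamma>0) \<in> borel_measurable borel"
    and conc: "conc K Z mX \<longlonglongrightarrow> Ct"
    and assm1: "assumption1 M K Z mX e X \<theta>"
    and gh: "\<And>n. gh n \<beta>0 \<in> borel_measurable (M n)" "conv_in_prob M (\<lambda>n. gh n \<beta>0) \<gamma>0"
    and assm3: "assumption3 a \<Gamma> \<gamma>0"
    and Hcont: "continuous_on UNIV H"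
    and Hbound: "\<And>A d. \<bar>H (A, 0, d)\<bar> \<le> C" "\<And>A d. \<bar>H (A, 1, d)\<bar> \<le> C"
  shows "(\<lambda>n. \<integral>\<omega>. H (A_hat K Z X Y \<beta>0 gh a s n \<omega>, phi_hat \<alpha> K Z X Y \<beta>0 gh a s n \<omega>, D_hat K Z X Y \<beta>0 gh n \<omega>) \<partial>M n)
    \<longlonglongrightarrow> (\<integral>(d, z). H (weights a s d \<gamma>0, phi_inf \<alpha> (weights a s d \<gamma>0) (rho_of \<gamma>0) z, d)
         \<partial>(normal_law (Ct * G_fun \<Delta> \<gamma>0) ((sigma_D \<gamma>0)^2) \<Otimes>\<^sub>M normal_pair (C1_num \<Delta> \<gamma>0 * Ct) (C2_num \<Delta> \<gamma>0 * Ct)))"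
proof -

  \<comment> \<open>The weakly convergent and the consistent component\<close>
  let ?lawD = "normal_law (Ct * G_fun \<Delta> \<gamma>0) ((sigma_D \<gamma>0)^2)"
  let ?NP = "normal_pair (C1_num \<Delta> \<gamma>0 * Ct) (C2_num \<Delta> \<gamma>0 * Ct)"
  let ?B3 = "borel \<Otimes>\<^sub>M (borel \<Otimes>\<^sub>M borel) :: (real \<times> real \<times> real) measure"
  have M: "prob_space (M n)" for n using model by (simp add: iv_model_def)
  obtain \<nu> and L :: "real^3^3" where L: "cov_matrix \<theta> = L ** Finite_Cartesian_Product.transpose L"
    and nu_def: "\<nu> = distr (PiM UNIV (\<lambda>_. std_normal_distribution)) borel (\<lambda>z. 0 + L *v (\<chi> i. z i))"
    and conv: "conv_in_law M
          (\<lambda>n \<omega>. vector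
             [Qform n (K n) (Z n) (\<lambda>i. e n i \<omega>) (\<lambda>i. e n i \<omega>),
              Qform n (K n) (Z n) (\<lambda>i. X n i \<omega>) (\<lambda>i. e n i \<omega>),
              Q_XX K Z X n \<omega> - conc K Z mX n] :: real^3) \<nu>"
  proof -
    obtain \<nu> where 1: "multivariate_normal 0 (cov_matrix \<theta>) \<nu>"
      and 2: "conv_in_law M
          (\<lambda>n \<omega>. vector
             [Qform n (K n) (Z n) (\<lambda>i. e n i \<omega>) (\<lambda>i. e n i \<omega>),
              Qform n (K n) (Z n) (\<lambda>i. X n i \<omega>) (\<lambda>i. e n i \<omega>),
              Q_XX K Z X n \<omega> - conc K Z mX n] :: real^3) \<nu>"
      using assm1 unfolding assumption1_def by (elim exE conjE) (rule that)
    then show ?thesis unfolding multivariate_normal_def by (elim exE conjE) (rule that)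
  qed
  have L_meas [measurable]: "(*v) L \<in> borel_measurable borel"
    by (intro borel_measurable_continuous_onI linear_continuous_on linear_conv_bounded_linear[THEN iffD1]) simp
  note sets_PiM_std_normal[measurable_cong]
  have nu: "\<nu> = distr std_normal_vec borel ((*v) L)"
    unfolding nu_def std_normal_vec_def by (subst distr_distr) (simp_all add: comp_def)
  have "prob_space (PiM (UNIV :: 3 set) (\<lambda>_. std_normal_distribution))"
    by (intro prob_space_PiM prob_space_std_normal)
  then have prob_nu: "prob_space \<nu>" "sets \<nu> = sets borel"
    unfolding nu_def by (auto intro!: prob_space.prob_space_distr)
  define W where "W n \<omega> = (vector
             [Qform n (K n) (Z n) (\<lambda>i. e n i \<omega>) (\<lambda>i. e n i \<omega>),
              Qform n (K n) (Z n) (\<lambda>i. X n i \<omega>) (\<lambda>i. e n i \<omega>),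
              Q_XX K Z X n \<omega> - conc K Z mX n] :: real^3)" for n \<omega>
  have convW: "conv_in_law M W \<nu>" using conv by (simp add: W_def[abs_def])
  have [measurable]: "(\<lambda>\<omega>. Qform n (K n) (Z n) (\<lambda>i. e n i \<omega>) (\<lambda>i. e n i \<omega>)) \<in> borel_measurable (M n)"
    "(\<lambda>\<omega>. Qform n (K n) (Z n) (\<lambda>i. X n i \<omega>) (\<lambda>i. e n i \<omega>)) \<in> borel_measurable (M n)"
    "(\<lambda>\<omega>. Q_XX K Z X n \<omega>) \<in> borel_measurable (M n)" for n
    unfolding Q_XX_def using iv_model_measurable[OF model, of _ n] by (auto intro!: Qform_measurable)
  have W_meas: "W n \<in> borel_measurable (M n)" for n
    unfolding W_def[abs_def] vector_3_eq by measurable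
  define G where "G n \<omega> = (gh n \<beta>0 \<omega>, conc K Z mX n)" for n \<omega>
  have G_meas: "G n \<in> borel_measurable (M n)" for n
    unfolding G_def[abs_def] using gh(1) by (intro borel_measurable_Pair) auto
  have convG: "conv_in_prob M G (\<gamma>0, Ct)"
    unfolding G_def[abs_def] by (rule conv_in_prob_Pair_const[OF M gh(2) gh(1) conc])

  \<comment> \<open>The statistics as functions of the limit vector, the estimator and the
    shift\<close>
  define qee where "qee p = inner (dir_ee \<Delta>) (fst p) + \<Delta>^2 * snd (snd p)" for p :: "(real^3) \<times> gam \<times> real"
  define qXe where "qXe p = inner (dir_Xe \<Delta>) (fst p) + \<Delta> * snd (snd p)" for p :: "(real^3) \<times> gam \<times> real"
  define qXX where "qXX p = inner dir_XX (fst p) + snd (snd p)" for p :: "(real^3) \<times> gam \<times> real"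
  define AR where "AR p = AR_stat (fst (snd p)) (qee p)" for p :: "(real^3) \<times> gam \<times> real"
  define LM where "LM p = LM_stat (fst (snd p)) (qXe p)" for p :: "(real^3) \<times> gam \<times> real"
  define LS where "LS p = LMstar_stat (fst (snd p)) (qee p) (qXe p)" for p :: "(real^3) \<times> gam \<times> real"
  define D where "D p = D_stat (fst (snd p)) (qee p) (qXe p) (qXX p)" for p :: "(real^3) \<times> gam \<times> real"
  define A where "A p = weights a s (D p) (fst (snd p))" for p :: "(real^3) \<times> gam \<times> real"
  define T where "T p = fst (A p) * (AR p)^2 + snd (A p) * (LM p)^2 + (1 - fst (A p) - snd (A p)) * (LS p)^2" for p
  define phi where "phi p = (if 1 - \<alpha> \<le> clc_cdf (A p) (rho_of (fst (snd p))) (T p) then 1 else 0 :: real)" for p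
  define F where "F p = H (A p, phi p, D p)" for p
  have Q: "Q_ee0 K Z X Y \<beta>0 n \<omega> = qee (W n \<omega>, G n \<omega>)" "Q_Xe0 K Z X Y \<beta>0 n \<omega> = qXe (W n \<omega>, G n \<omega>)"
    "Q_XX K Z X n \<omega> = qXX (W n \<omega>, G n \<omega>)" if "\<omega> \<in> space (M n)" for n \<omega>
    unfolding Qform_residual[OF model that Delta_def]
    by (simp_all add: qee_def qXe_def qXX_def W_def G_def dir_ee_def dir_Xe_def dir_XX_def inner_vec_def sum_3 algebra_simps)
  have D_hat_eq: "D_hat K Z X Y \<beta>0 gh n \<omega> = D (W n \<omega>, G n \<omega>)" if "\<omega> \<in> space (M n)" for n \<omega>
    unfolding D_hat_def Q[OF that] by (simp add: D_def G_def)
  have A_hat_eq: "A_hat K Z X Y \<beta>0 gh a s n \<omega> = A (W n \<omega>, G n \<omega>)" if "\<omega> \<in> space (M n)" for n \<omega>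
    unfolding A_hat_def D_hat_eq[OF that] by (simp add: A_def G_def)
  have phi_hat_eq: "phi_hat \<alpha> K Z X Y \<beta>0 gh a s n \<omega> = phi (W n \<omega>, G n \<omega>)" if "\<omega> \<in> space (M n)" for n \<omega>
    unfolding phi_hat_def A_hat_eq[OF that] Q[OF that] clc_test_eq[OF level]
    by (simp add: phi_def T_def AR_def LM_def LS_def G_def)

  \<comment> \<open>Measurability\<close>
  have qc: "isCont qee p" "isCont qXe p" "isCont qXX p" for p
    unfolding qee_def[abs_def] qXe_def[abs_def] qXX_def[abs_def] by (intro continuous_intros)+
  have [measurable]: "qee \<in> borel_measurable borel" "qXe \<in> borel_measurable borel" "qXX \<in> borel_measurable borel"
    using qc by (auto intro!: borel_measurable_continuous_onI continuous_at_imp_continuous_on)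
  have WG_meas [measurable]: "(\<lambda>\<omega>. (W n \<omega>, G n \<omega>)) \<in> borel_measurable (M n)" for n
    by (intro borel_measurable_Pair W_meas G_meas)
  have g_meas: "(\<lambda>p::(real^3) \<times> gam \<times> real. f (fst (snd p))) \<in> borel_measurable borel" if "f \<in> borel_measurable borel" for f :: "gam \<Rightarrow> real"
    by (rule measurable_compose[OF _ that]) (intro borel_measurable_continuous_onI continuous_intros)
  have [measurable]: "(\<lambda>p::(real^3) \<times> gam \<times> real. proj_coef (fst (snd p)) $ i) \<in> borel_measurable borel" for i
    by (rule g_meas[OF proj_coef_measurable])
  have [measurable]: "(\<lambda>p::(real^3) \<times> gam \<times> real. rho_of (fst (snd p))) \<in> borel_measurable borel"
    by (rule g_meas[OF rho_of_measurable])
  have [measurable]: "(\<lambda>p::(real^3) \<times> gam \<times> real. fst (fst (snd p))) \<in> borel_measurable borel"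
    "(\<lambda>p::(real^3) \<times> gam \<times> real. fst (snd (snd (snd (fst (snd p)))))) \<in> borel_measurable borel"
    by (intro borel_measurable_continuous_onI continuous_intros)+
  have D_meas [measurable]: "D \<in> borel_measurable borel"
    unfolding D_def[abs_def] D_stat_alt by measurable
  have stat_meas [measurable]: "AR \<in> borel_measurable borel" "LM \<in> borel_measurable borel" "LS \<in> borel_measurable borel"
    unfolding AR_def[abs_def] LM_def[abs_def] LS_def[abs_def] LMstar_stat_def AR_stat_alt LM_stat_alt by measurable
  have fs_meas [measurable]: "(fst :: real \<times> real \<Rightarrow> real) \<in> borel_measurable borel" "(snd :: real \<times> real \<Rightarrow> real) \<in> borel_measurable borel"
    by (intro borel_measurable_continuous_onI continuous_intros)+
  have H_meas [measurable]: "H \<in> borel_measurable borel"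
    by (rule borel_measurable_continuous_onI[OF Hcont])
  have F_meas: "(\<lambda>\<omega>. F (W n \<omega>, G n \<omega>)) \<in> borel_measurable (M n)" for n
  proof -
    \<comment> \<open>Taken from the hypothesis on \<open>A_hat\<close>; the weights are not known
      to be measurable jointly in \<open>(d, r)\<close>.\<close>
    have [measurable]: "(\<lambda>\<omega>. A (W n \<omega>, G n \<omega>)) \<in> borel_measurable (M n)"
      using A_meas[of n] by (subst measurable_cong[where g = "A_hat K Z X Y \<beta>0 gh a s n"]) (simp_all add: A_hat_eq)
    have [measurable]: "(\<lambda>\<omega>. T (W n \<omega>, G n \<omega>)) \<in> borel_measurable (M n)"
      unfolding T_def by measurable
    have [measurable]: "(\<lambda>\<omega>. clc_cdf (A (W n \<omega>, G n \<omega>)) (rho_of (fst (snd (W n \<omega>, G n \<omega>)))) (T (W n \<omega>, G n \<omega>))) \<in> borel_measurable (M n)"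
    proof (rule measurable_clc_cdf)
      show "(\<lambda>\<omega>. rho_of (fst (snd (W n \<omega>, G n \<omega>)))) \<in> borel_measurable (M n)"
        by (rule measurable_compose[OF WG_meas]) measurable
    qed measurable
    have [measurable]: "(\<lambda>\<omega>. phi (W n \<omega>, G n \<omega>)) \<in> borel_measurable (M n)"
      unfolding phi_def by measurable
    have "(\<lambda>\<omega>. (A (W n \<omega>, G n \<omega>), phi (W n \<omega>, G n \<omega>), D (W n \<omega>, G n \<omega>))) \<in> borel_measurable (M n)"
      by (intro borel_measurable_Pair) measurable
    then show ?thesis unfolding F_def by measurable
  qed

  \<comment> \<open>The limit integral in terms of \<open>D\<close> and the noise\<close>
  have rho_eq: "rho_of \<gamma>0 = rho_at \<theta> \<Delta>" by (simp add: gamma0_def gamma_at_def)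
  have rho1: "\<bar>rho_of \<gamma>0\<bar> < 1" using rho by (simp add: rho_eq)
  define k where "k q = H (weights a s (fst q) \<gamma>0, phi_inf \<alpha> (weights a s (fst q) \<gamma>0) (rho_of \<gamma>0) (snd q), fst q)"
    for q :: "real \<times> real \<times> real"
  define J where "J w = (D (w, \<gamma>0, Ct), AR (w, \<gamma>0, Ct), LS (w, \<gamma>0, Ct))" for w
  have T_eq: "T (w, \<gamma>0, Ct) = clc_stat (A (w, \<gamma>0, Ct)) (rho_of \<gamma>0) (AR (w, \<gamma>0, Ct), LS (w, \<gamma>0, Ct))" for w
    by (simp add: T_def clc_stat_def AR_def LM_def LS_def LM_stat_eq[OF rho1, of "qXe _" "qee (w, \<gamma>0, Ct)"])
  have Fk: "F (w, \<gamma>0, Ct) = k (J w)" for w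
    by (simp add: F_def k_def J_def phi_def T_eq phi_inf_eq[OF level] A_def)
  have J_meas: "J \<in> borel \<rightarrow>\<^sub>M ?B3"
  proof -
    have [measurable]: "(\<lambda>w. (w, \<gamma>0, Ct)) \<in> borel_measurable borel"
      by (intro borel_measurable_continuous_onI continuous_intros)
    show ?thesis unfolding J_def[abs_def] by measurable
  qed
  have w_meas: "(\<lambda>q. weights a s (fst q) \<gamma>0) \<in> borel_measurable ?B3"
    by (rule measurable_compose[OF measurable_fst weights_meas])
  note cdf_meas = measurable_clc_cdf_selection[OF weights_meas, of "rho_of \<gamma>0"]
  have k_meas: "k \<in> borel_measurable ?B3"
  proof -
    have "(\<lambda>q. (weights a s (fst q) \<gamma>0, phi_inf \<alpha> (weights a s (fst q) \<gamma>0) (rho_of \<gamma>0) (snd q), fst q)) \<in> borel_measurable ?B3"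
      by (intro borel_measurable_Pair w_meas measurable_phi_inf_selection[OF level weights_meas] measurable_fst)
    then show ?thesis unfolding k_def[abs_def] by measurable
  qed
  have law: "distr \<nu> ?B3 J = ?lawD \<Otimes>\<^sub>M ?NP"
  proof -
    have "distr \<nu> ?B3 J = distr std_normal_vec ?B3 (\<lambda>z. J (L *v z))"
      unfolding nu using J_meas by (subst distr_distr) (simp_all add: comp_def)
    also have "\<dots> = ?lawD \<Otimes>\<^sub>M ?NP"
      using distr_limit_statistics[OF L pos rho gamma0_def, of Ct]
      by (simp add: J_def D_def AR_def LS_def qee_def qXe_def qXX_def)
    finally show ?thesis .
  qed
  have J_meas': "J \<in> \<nu> \<rightarrow>\<^sub>M ?B3" using J_meas prob_nu(2) by (simp cong: measurable_cong_sets)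
  have lim_eq: "(\<integral>w. F (w, \<gamma>0, Ct) \<partial>\<nu>) = (\<integral>q. k q \<partial>(?lawD \<Otimes>\<^sub>M ?NP))"
    unfolding law[symmetric] Fk by (rule integral_distr[symmetric, OF J_meas' k_meas])

  \<comment> \<open>The exceptional null set\<close>
  obtain N where N: "discont a s \<gamma>0 \<subseteq> N" "N \<in> sets borel" "AE d in ?lawD. d \<notin> N"
  proof (cases "sigma_D \<gamma>0 = 0")
    case True
    then show ?thesis using that[of "{}"] by (simp add: discont_degenerate)
  next
    case False
    have "discont a s \<gamma>0 \<in> null_sets (completion lborel)" using assm3 by (simp add: assumption3_def)
    \<comment> \<open>The discontinuity set is merely a Lebesgue null set; a Borel null superset is
      needed for Fubini.\<close>
    then obtain N where "N \<in> null_sets lborel" "discont a s \<gamma>0 \<subseteq> N"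
      unfolding null_sets_completion_iff2 by (elim bexE) (rule that)
    then show ?thesis using False by (intro that[of N] AE_normal_law) auto
  qed
  have AE1: "AE q in ?lawD \<Otimes>\<^sub>M ?NP. fst q \<notin> N \<and>
      clc_cdf (weights a s (fst q) \<gamma>0) (rho_of \<gamma>0) (clc_stat (weights a s (fst q) \<gamma>0) (rho_of \<gamma>0) (fst (snd q), snd (snd q))) \<noteq> 1 - \<alpha>"
  proof -
    interpret P1: prob_space ?lawD by (rule prob_space_normal_law) simp
    interpret P2: prob_space ?NP by (rule prob_space_normal_pair)
    interpret P: pair_sigma_finite ?lawD ?NP ..
    have s3: "sets (?lawD \<Otimes>\<^sub>M ?NP) = sets ?B3"
      by (intro sets_pair_measure_cong sets_normal_pair) simp
    show ?thesis
    proof (rule P.AE_pair_measure)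
      have "{q \<in> space ?B3. fst q \<notin> N \<and>
        clc_cdf (weights a s (fst q) \<gamma>0) (rho_of \<gamma>0) (clc_stat (weights a s (fst q) \<gamma>0) (rho_of \<gamma>0) (fst (snd q), snd (snd q))) \<noteq> 1 - \<alpha>} \<in> sets ?B3"
      proof (rule sets.sets_Collect_conj)
        show "{q \<in> space ?B3. fst q \<notin> N} \<in> sets ?B3"
          using measurable_sets[OF measurable_fst, of "- N" borel "borel \<Otimes>\<^sub>M borel :: (real \<times> real) measure"] N(2)
          by (simp add: vimage_def Int_def conj_commute)
      qed (rule borel_measurable_neq[OF cdf_meas borel_measurable_const])
      then show "{q \<in> space (?lawD \<Otimes>\<^sub>M ?NP). fst q \<notin> N \<and>
        clc_cdf (weights a s (fst q) \<gamma>0) (rho_of \<gamma>0) (clc_stat (weights a s (fst q) \<gamma>0) (rho_of \<gamma>0) (fst (snd q), snd (snd q))) \<noteq> 1 - \<alpha>} \<in> sets (?lawD \<Otimes>\<^sub>M ?NP)"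
        unfolding s3 sets_eq_imp_space_eq[OF s3] .
      show "AE d in ?lawD. AE z in ?NP. fst (d, z) \<notin> N \<and>
        clc_cdf (weights a s (fst (d, z)) \<gamma>0) (rho_of \<gamma>0) (clc_stat (weights a s (fst (d, z)) \<gamma>0) (rho_of \<gamma>0) (fst (snd (d, z)), snd (snd (d, z)))) \<noteq> 1 - \<alpha>"
        using N(3)
      proof eventually_elim
        case (elim d)
        \<comment> \<open>For fixed \<open>d\<close> the weights are constants, by the product form
          of the limit law.\<close>
        have "AE z in ?NP. clc_cdf (weights a s d \<gamma>0) (rho_of \<gamma>0) (clc_stat (weights a s d \<gamma>0) (rho_of \<gamma>0) z) \<noteq> 1 - \<alpha>"
          using level by (intro AE_clc_cdf_neq[OF weights_A0 abar rho1]) auto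
        then show ?case using elim by simp
      qed
    qed
  qed
  have AE2: "AE w in \<nu>. D (w, \<gamma>0, Ct) \<notin> N \<and> clc_cdf (A (w, \<gamma>0, Ct)) (rho_of \<gamma>0) (T (w, \<gamma>0, Ct)) \<noteq> 1 - \<alpha>"
    using AE_distrD[OF J_meas' AE1[folded law]] by (simp add: J_def T_eq A_def)

  \<comment> \<open>Continuity off the exceptional set\<close>
  have cont: "continuous (at (w, \<gamma>0, Ct) within UNIV \<times> \<Gamma> \<times> UNIV) F"
    if dN: "D (w, \<gamma>0, Ct) \<notin> N" and ne: "clc_cdf (A (w, \<gamma>0, Ct)) (rho_of \<gamma>0) (T (w, \<gamma>0, Ct)) \<noteq> 1 - \<alpha>" for w
  proof -
    let ?p = "(w, \<gamma>0, Ct)"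
    let ?S = "UNIV \<times> \<Gamma> \<times> UNIV :: ((real^3) \<times> gam \<times> real) set"
    note cw = continuous_at_imp_continuous_within
    have det: "gram_det \<gamma>0 \<noteq> 0" using gram_det_gamma_at[OF pos rho] by (simp add: gamma0_def)
    have cg: "isCont (\<lambda>p::(real^3) \<times> gam \<times> real. fst (snd p)) ?p" by (intro continuous_intros)
    have cp: "isCont (\<lambda>p. proj_coef (fst (snd p)) $ i) ?p" for i
      using isCont_proj_coef[OF det, of i] by (intro isCont_o2[OF cg]) simp
    have cD: "isCont D ?p"
      unfolding D_def[abs_def] D_stat_alt by (intro continuous_intros cp qc)
    have pos': "sqrt (fst \<gamma>0) \<noteq> 0" "sqrt (fst (snd (snd (snd \<gamma>0)))) \<noteq> 0"
      using pos by (simp_all add: gamma0_def gamma_at_def)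
    have rho': "sqrt (1 - (rho_of \<gamma>0)^2) \<noteq> 0" using rho1 abs_square_less_1[of "rho_of \<gamma>0"] by simp
    have cr: "isCont (\<lambda>p::(real^3) \<times> gam \<times> real. rho_of (fst (snd p))) ?p"
      unfolding rho_of_alt by (intro continuous_intros)
    have cAR: "isCont AR ?p"
      unfolding AR_def[abs_def] AR_stat_alt using pos' by (intro continuous_intros qc) auto
    have cLM: "isCont LM ?p"
      unfolding LM_def[abs_def] LM_stat_alt using pos' by (intro continuous_intros qc) auto
    have cLS: "isCont LS ?p"
      unfolding LS_def[abs_def] LMstar_stat_def AR_def[symmetric] LM_def[symmetric] using rho'
      by (intro continuous_intros cr cAR cLM) auto
    have "continuous (at (D ?p, \<gamma>0) within UNIV \<times> \<Gamma>) (\<lambda>(d', r). weights a s d' r)"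
      using assm3 N(1) dN unfolding assumption3_def by blast
    \<comment> \<open>The domain \<open>?S\<close> keeps the estimator in \<Gamma>, so its image
      lies where relative continuity is assumed.\<close>
    then have "continuous (at (D ?p, fst (snd ?p)) within (\<lambda>p. (D p, fst (snd p))) ` ?S) (\<lambda>(d', r). weights a s d' r)"
      unfolding snd_conv fst_conv by (rule continuous_within_subset) auto
    moreover have "continuous (at ?p within ?S) (\<lambda>p. (D p, fst (snd p)))"
      by (rule continuous_Pair[OF cw[OF cD] cw[OF cg]])
    ultimately have cA: "continuous (at ?p within ?S) A"
      using continuous_within_compose2[of ?p ?S "\<lambda>p. (D p, fst (snd p))" "\<lambda>(d', r). weights a s d' r"]
      by (simp add: A_def[abs_def])
    have cT: "continuous (at ?p within ?S) T"
      unfolding T_def[abs_def] by (intro continuous_intros cA cw[OF cAR] cw[OF cLM] cw[OF cLS])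
    have "isCont (\<lambda>(a, \<rho>, x). clc_cdf a \<rho> x) (A ?p, rho_of (fst (snd ?p)), T ?p)"
      using weights_A0 abar rho1 by (intro isCont_clc_cdf) (auto simp: A_def)
    then have "isCont (\<lambda>(a, \<rho>, x). clc_cdf a \<rho> x) ((\<lambda>p. (A p, rho_of (fst (snd p)), T p)) ?p)" by simp
    from continuous_within_compose3[OF this continuous_Pair[OF cA continuous_Pair[OF cw[OF cr] cT]]]
    have cC: "continuous (at ?p within ?S) (\<lambda>p. clc_cdf (A p) (rho_of (fst (snd p))) (T p))"
      by simp
    then have lim: "((\<lambda>p. clc_cdf (A p) (rho_of (fst (snd p))) (T p)) \<longlongrightarrow> clc_cdf (A ?p) (rho_of \<gamma>0) (T ?p)) (at ?p within ?S)"
      by (simp add: continuous_within)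
    \<comment> \<open>The decision is locally constant, since the distribution function is
      continuous and differs from the threshold \<open>1 - \<alpha>\<close>.\<close>
    have "\<forall>\<^sub>F p in at ?p within ?S. phi p = phi ?p"
    proof (cases "1 - \<alpha> < clc_cdf (A ?p) (rho_of \<gamma>0) (T ?p)")
      case True
      show ?thesis using order_tendstoD(1)[OF lim True] by eventually_elim (use True in \<open>simp add: phi_def\<close>)
    next
      case False
      then have less: "clc_cdf (A ?p) (rho_of \<gamma>0) (T ?p) < 1 - \<alpha>" using ne by simp
      show ?thesis using order_tendstoD(2)[OF lim less] by eventually_elim (use less in \<open>simp add: phi_def\<close>)
    qed
    then have cphi: "continuous (at ?p within ?S) phi"
      by (simp add: continuous_within tendsto_eventually)
    have "isCont H ((\<lambda>p. (A p, phi p, D p)) ?p)"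
      using Hcont unfolding continuous_on_eq_continuous_at[OF open_UNIV] by blast
    from continuous_within_compose3[OF this continuous_Pair[OF cA continuous_Pair[OF cphi cw[OF cD]]]]
    show ?thesis by (simp add: F_def[abs_def])
  qed

  \<comment> \<open>Application of the mapping theorem\<close>
  have "(\<lambda>n. \<integral>\<omega>. F (W n \<omega>, G n \<omega>) \<partial>M n) \<longlonglongrightarrow> (\<integral>w. F (w, \<gamma>0, Ct) \<partial>\<nu>)"
  proof (rule conv_in_law_prob_mapping[OF M prob_nu W_meas convW G_meas convG, of "\<Gamma> \<times> UNIV" F C])
    show "\<bar>F p\<bar> \<le> C" for p using Hbound by (simp add: F_def phi_def)
    show "(\<lambda>w. F (w, \<gamma>0, Ct)) \<in> borel_measurable \<nu>"
      unfolding Fk by (rule measurable_compose[OF J_meas' k_meas])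
    show "AE w in \<nu>. continuous (at (w, \<gamma>0, Ct) within UNIV \<times> \<Gamma> \<times> UNIV) F"
      using AE2 by eventually_elim (auto intro: cont)
  qed (use Gamma F_meas in \<open>auto simp: G_def\<close>)
  moreover have "(\<integral>\<omega>. F (W n \<omega>, G n \<omega>) \<partial>M n) = (\<integral>\<omega>. H (A_hat K Z X Y \<beta>0 gh a s n \<omega>, phi_hat \<alpha> K Z X Y \<beta>0 gh a s n \<omega>, D_hat K Z X Y \<beta>0 gh n \<omega>) \<partial>M n)" for n
    by (rule Bochner_Integration.integral_cong) (simp_all add: F_def A_hat_eq phi_hat_eq D_hat_eq)
  ultimately show ?thesis
    unfolding lim_eq by (simp add: k_def[abs_def] split_beta')
qed

theorem theorem4p1:
  fixes M :: "nat \<Rightarrow> 'a measure"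
    and K :: "nat \<Rightarrow> nat" and Z :: "nat \<Rightarrow> real mat"
    and mX :: "nat \<Rightarrow> nat \<Rightarrow> real"
    and V e X Y :: "nat \<Rightarrow> nat \<Rightarrow> 'a \<Rightarrow> real"
    and \<beta> \<beta>0 \<Delta> Ct \<alpha> abar :: real
    and B :: "real set" and \<theta> :: cov_param and \<Gamma> :: "gam set" and \<gamma>0 :: gam
    and gh :: "nat \<Rightarrow> real \<Rightarrow> 'a \<Rightarrow> gam"
    and a :: "real \<Rightarrow> gam \<Rightarrow> real \<times> real"
    and \<mu>D :: real and lawD :: "real measure"
  assumes model: "iv_model M K Z \<beta> mX V e X Y"
    and level: "0 < \<alpha>" "\<alpha> < 1"
    and abar: "abar < 1"
    and Delta_def: "\<Delta> = \<beta> - \<beta>0"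
    and gamma0_def: "\<gamma>0 = gamma_at \<theta> \<Delta>"
    and rho: "rho_at \<theta> \<Delta> \<in> {-1<..<1}"
    and beta0: "\<beta>0 \<in> B"
    and Gamma: "\<gamma>0 \<in> \<Gamma>" "\<And>n \<omega>. \<omega> \<in> space (M n) \<Longrightarrow> gh n \<beta>0 \<omega> \<in> \<Gamma>"
    and selection: "weight_selection \<alpha> abar B \<beta>0 \<Gamma> a"
    and selection_measurable:
      "\<And>s n. A_hat K Z X Y \<beta>0 gh a s n \<in> borel_measurable (M n)"
      "\<And>s. (\<lambda>d. weights a s d \<gamma>0) \<in> borel_measurable borel"
    and weak_identification: "conc K Z mX \<longlonglongrightarrow> Ct"
    and assm1: "assumption1 M K Z mX e X \<theta>"
    and assm2: "assumption2 M B \<beta> \<theta> gh"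
    and assm3: "assumption3 a \<Gamma> \<gamma>0"
    and muD_def: "\<mu>D = Ct * G_fun \<Delta> \<gamma>0"
    and lawD_def: "lawD = normal_law \<mu>D ((sigma_D \<gamma>0)^2)"
  shows
    "\<forall>s.
       conv_in_law M (A_hat K Z X Y \<beta>0 gh a s) (distr lawD borel (\<lambda>d. weights a s d \<gamma>0)) \<and>
       (\<lambda>n. \<integral>\<omega>. phi_hat \<alpha> K Z X Y \<beta>0 gh a s n \<omega> \<partial>M n)
         \<longlonglongrightarrow> (\<integral>(d, z). phi_inf \<alpha> (weights a s d \<gamma>0) (rho_of \<gamma>0) z
               \<partial>(lawD \<Otimes>\<^sub>M normal_pair (C1_num \<Delta> \<gamma>0 * Ct) (C2_num \<Delta> \<gamma>0 * Ct))) \<and>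
       (G_fun \<Delta> \<gamma>0 \<noteq> 0 \<longrightarrow>
         (\<lambda>n. \<integral>\<omega>. phi_hat \<alpha> K Z X Y \<beta>0 gh a s n \<omega> \<partial>M n)
           \<longlonglongrightarrow> (\<integral>(d, z). phi_inf \<alpha> (weights a s d \<gamma>0) (rho_of \<gamma>0) z
                 \<partial>(lawD \<Otimes>\<^sub>M noise \<Delta> \<mu>D \<gamma>0))) \<and>
       (\<Delta> = 0 \<longrightarrow>
         (\<forall>h :: real \<Rightarrow> real. bounded (range h) \<and> 1-lipschitz_on UNIV h \<longrightarrow>
           (\<lambda>n. \<integral>\<omega>. (phi_hat \<alpha> K Z X Y \<beta>0 gh a s n \<omega> - \<alpha>) * h (D_hat K Z X Y \<beta>0 gh n \<omega>) \<partial>M n)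
             \<longlonglongrightarrow> 0))"
proof -
  let ?NP = "normal_pair (C1_num \<Delta> \<gamma>0 * Ct) (C2_num \<Delta> \<gamma>0 * Ct)"
  have pos: "0 < Phi1_at \<theta> \<Delta>" "0 < Psi_at \<theta> \<Delta>"
    using assm2 beta0 pos_of_INF_pos[OF _ beta0 continuous_Phi1_at, where \<beta> = \<beta>]
      pos_of_INF_pos[OF _ beta0 continuous_Psi_at, where \<beta> = \<beta>]
    unfolding assumption2_def Delta_def by auto
  have rho': "\<bar>rho_at \<theta> \<Delta>\<bar> < 1" using rho by auto
  have rho1: "\<bar>rho_of \<gamma>0\<bar> < 1" using rho' by (simp add: gamma0_def gamma_at_def)
  have gh: "\<And>n. gh n \<beta>0 \<in> borel_measurable (M n)" "conv_in_prob M (\<lambda>n. gh n \<beta>0) \<gamma>0"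
    using assm2 beta0 by (auto simp: assumption2_def gamma0_def Delta_def)
  have wA0: "weights a s d \<gamma>0 \<in> A0 abar" for s d
    using selection Gamma(1) by (auto simp: weight_selection_def is_arg_min_def weights_def Aset_def)
  note conv = conv_feasible_test[OF model level abar Delta_def gamma0_def rho' pos Gamma wA0
      selection_measurable weak_identification assm1 gh assm3]
  interpret P1: prob_space lawD unfolding lawD_def by (rule prob_space_normal_law) simp
  interpret P2: prob_space ?NP by (rule prob_space_normal_pair)
  interpret P: pair_prob_space lawD ?NP ..
  have sD: "sets lawD = sets borel" by (simp add: lawD_def)
  have wm: "(\<lambda>d. weights a s d \<gamma>0) \<in> borel_measurable lawD" for s
    using selection_measurable(2)[of s] sD by (simp cong: measurable_cong_sets)
  have law_eq: "normal_law (Ct * G_fun \<Delta> \<gamma>0) ((sigma_D \<gamma>0)^2) = lawD"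
    by (simp add: lawD_def muD_def)
  show ?thesis
  proof (intro allI conjI impI)
    fix s
    show "conv_in_law M (A_hat K Z X Y \<beta>0 gh a s) (distr lawD borel (\<lambda>d. weights a s d \<gamma>0))"
      unfolding conv_in_law_def
    proof (intro allI impI)
      fix f :: "real \<times> real \<Rightarrow> real" assume f: "continuous_on UNIV f \<and> bounded (range f)"
      then obtain C where C: "\<And>x. \<bar>f x\<bar> \<le> C" by (auto simp: bounded_iff)
      have fm: "f \<in> borel_measurable borel" using f by (intro borel_measurable_continuous_onI) simp
      have Hc: "continuous_on UNIV (\<lambda>q::(real \<times> real) \<times> real \<times> real. f (fst q))"
        by (rule continuous_on_compose2[of UNIV f]) (use f in \<open>auto intro!: continuous_intros\<close>)
      have "(\<lambda>n. \<integral>\<omega>. f (A_hat K Z X Y \<beta>0 gh a s n \<omega>) \<partial>M n)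
          \<longlonglongrightarrow> (\<integral>(d, z). f (weights a s d \<gamma>0) \<partial>(lawD \<Otimes>\<^sub>M ?NP))"
        using conv[where H = "\<lambda>q. f (fst q)" and C = C and s = s, OF _ Hc] C unfolding law_eq by simp
      also have "(\<integral>(d, z). f (weights a s d \<gamma>0) \<partial>(lawD \<Otimes>\<^sub>M ?NP))
          = (\<integral>d. f (weights a s d \<gamma>0) \<partial>distr (lawD \<Otimes>\<^sub>M ?NP) lawD fst)"
        using measurable_compose[OF wm[of s] fm] by (subst integral_distr) (auto simp: split_beta')
      also have "\<dots> = (\<integral>x. f x \<partial>distr lawD borel (\<lambda>d. weights a s d \<gamma>0))"
        unfolding P2.distr_pair_fst by (rule integral_distr[OF wm fm, symmetric])
      finally show "(\<lambda>n. \<integral>\<omega>. f (A_hat K Z X Y \<beta>0 gh a s n \<omega>) \<partial>M n)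
          \<longlonglongrightarrow> (\<integral>x. f x \<partial>distr lawD borel (\<lambda>d. weights a s d \<gamma>0))" .
    qed
  next
    fix s
    show power: "(\<lambda>n. \<integral>\<omega>. phi_hat \<alpha> K Z X Y \<beta>0 gh a s n \<omega> \<partial>M n)
         \<longlonglongrightarrow> (\<integral>(d, z). phi_inf \<alpha> (weights a s d \<gamma>0) (rho_of \<gamma>0) z \<partial>(lawD \<Otimes>\<^sub>M ?NP))"
    proof -
      have Hc: "continuous_on UNIV (\<lambda>q::(real \<times> real) \<times> real \<times> real. fst (snd q))"
        by (intro continuous_intros)
      show ?thesis
        using conv[where H = "\<lambda>q. fst (snd q)" and C = 1 and s = s, OF _ Hc] unfolding law_eq by simp
    qed
    assume "G_fun \<Delta> \<gamma>0 \<noteq> 0"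
    \<comment> \<open>The factor \<open>G_fun\<close> in \<open>\<mu>D\<close> cancels the
      denominators of \<open>C1\<close> and \<open>C2\<close>.\<close>
    then have "noise \<Delta> \<mu>D \<gamma>0 = ?NP"
      by (simp add: noise_def C1_def C2_def muD_def mult.commute)
    with power show "(\<lambda>n. \<integral>\<omega>. phi_hat \<alpha> K Z X Y \<beta>0 gh a s n \<omega> \<partial>M n)
           \<longlonglongrightarrow> (\<integral>(d, z). phi_inf \<alpha> (weights a s d \<gamma>0) (rho_of \<gamma>0) z \<partial>(lawD \<Otimes>\<^sub>M noise \<Delta> \<mu>D \<gamma>0))"
      by simp
  next
    fix s and h :: "real \<Rightarrow> real"
    assume \<Delta>0: "\<Delta> = 0" and h: "bounded (range h) \<and> 1-lipschitz_on UNIV h"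
    have hc: "continuous_on UNIV h" using h lipschitz_on_continuous_on by blast
    obtain C where C: "\<And>x. \<bar>h x\<bar> \<le> C" using h by (auto simp: bounded_iff)
    have bd: "\<bar>(t - \<alpha>) * h x\<bar> \<le> C" if "t = 0 \<or> t = 1" for t x
    proof -
      have "\<bar>t - \<alpha>\<bar> * \<bar>h x\<bar> \<le> 1 * C" using that level C[of x] by (intro mult_mono) auto
      then show ?thesis by (simp add: abs_mult)
    qed
    let ?F = "\<lambda>(d, z). (phi_inf \<alpha> (weights a s d \<gamma>0) (rho_of \<gamma>0) z - \<alpha>) * h d"
    have Hc: "continuous_on UNIV (\<lambda>q::(real \<times> real) \<times> real \<times> real. (fst (snd q) - \<alpha>) * h (snd (snd q)))"
      by (intro continuous_intros continuous_on_compose2[OF hc]) auto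
    have "(\<lambda>n. \<integral>\<omega>. (phi_hat \<alpha> K Z X Y \<beta>0 gh a s n \<omega> - \<alpha>) * h (D_hat K Z X Y \<beta>0 gh n \<omega>) \<partial>M n)
        \<longlonglongrightarrow> (\<integral>q. ?F q \<partial>(lawD \<Otimes>\<^sub>M ?NP))"
      using conv[where H = "\<lambda>q. (fst (snd q) - \<alpha>) * h (snd (snd q))" and C = C and s = s, OF _ Hc] bd[of 0] bd[of 1] unfolding law_eq by simp
    also have "(\<integral>q. ?F q \<partial>(lawD \<Otimes>\<^sub>M ?NP)) = 0"
    proof -
      have s3: "sets (lawD \<Otimes>\<^sub>M ?NP) = sets (borel \<Otimes>\<^sub>M (borel \<Otimes>\<^sub>M borel))"
        using sD by (intro sets_pair_measure_cong sets_normal_pair)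
      have [measurable]: "h \<in> borel_measurable borel" by (rule borel_measurable_continuous_onI[OF hc])
      have "?F \<in> borel_measurable (borel \<Otimes>\<^sub>M (borel \<Otimes>\<^sub>M borel))"
      proof -
        have [measurable]: "(\<lambda>q. phi_inf \<alpha> (weights a s (fst q) \<gamma>0) (rho_of \<gamma>0) (snd q)) \<in> borel_measurable (borel \<Otimes>\<^sub>M (borel \<Otimes>\<^sub>M borel))"
          using level selection_measurable(2) by (rule measurable_phi_inf_selection)
        show ?thesis by (simp add: split_beta')
      qed
      then have Fm: "?F \<in> borel_measurable (lawD \<Otimes>\<^sub>M ?NP)" using s3 by (simp cong: measurable_cong_sets)
      have int: "integrable (lawD \<Otimes>\<^sub>M ?NP) ?F"
        by (rule P.P.integrable_const_bound[of _ C]) (use bd Fm in \<open>auto simp: phi_inf_def\<close>)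
      have "(\<integral>q. ?F q \<partial>(lawD \<Otimes>\<^sub>M ?NP)) = (\<integral>d. \<integral>z. ?F (d, z) \<partial>?NP \<partial>lawD)"
        by (rule P.integral_fst'[OF int, symmetric])
      \<comment> \<open>Already the inner integral vanishes: given \<open>d\<close>, the factor
        \<open>h d\<close> is constant and the conditional rejection probability is
        \<alpha>.\<close>
      also have "\<dots> = (\<integral>d. 0 \<partial>lawD)"
      proof (rule Bochner_Integration.integral_cong[OF refl])
        fix d
        \<comment> \<open>Both \<open>C1_num\<close> and \<open>C2_num\<close> vanish at
          \<open>\<Delta> = 0\<close>, so the noise is centred whatever the value of
          \<open>Ct\<close>.\<close>
        have NP0: "?NP = normal_pair 0 0"
          using \<Delta>0 by (cases \<gamma>0) auto
        have "integrable ?NP (phi_inf \<alpha> (weights a s d \<gamma>0) (rho_of \<gamma>0))"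
        proof (rule P2.integrable_const_bound[of _ 1])
          show "phi_inf \<alpha> (weights a s d \<gamma>0) (rho_of \<gamma>0) \<in> borel_measurable ?NP"
            unfolding phi_inf_def[abs_def] using clc_stat_pair_measurable by measurable
        qed (simp add: phi_inf_def)
        then have "(\<integral>z. (phi_inf \<alpha> (weights a s d \<gamma>0) (rho_of \<gamma>0) z - \<alpha>) * h d \<partial>?NP)
            = ((\<integral>z. phi_inf \<alpha> (weights a s d \<gamma>0) (rho_of \<gamma>0) z \<partial>?NP) - \<alpha>) * h d"
          using P2.prob_space by (simp add: Bochner_Integration.integral_diff)
        also have "\<dots> = 0"
          unfolding NP0 using integral_phi_inf_null[OF wA0 abar rho1 level] by simp
        finally show "(\<integral>z. ?F (d, z) \<partial>?NP) = 0" by simp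
      qed
      finally show ?thesis by simp
    qed
    finally show "(\<lambda>n. \<integral>\<omega>. (phi_hat \<alpha> K Z X Y \<beta>0 gh a s n \<omega> - \<alpha>) * h (D_hat K Z X Y \<beta>0 gh n \<omega>) \<partial>M n) \<longlonglongrightarrow> 0" .
  qed
qed

end
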